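(* Let $G$ be a finite simple graph on the vertex set $[\ell]=\{1,\dots,\ell\}$ and let $q$ be a prime power. Write $\chi(\mathcal{A}_G^q,t)=\sum_{i=0}^{\ell}c_i\,t_q^{\underline{i}}$. Then for each $i$ the number $c_i/(q-1)^{\ell-i}$ is a non-negative integer, and it is congruent modulo $q-1$ to the number of stable partitions of $G$ into $i$ blocks.
   Context: $\mathbb{F}_q$ is the field with $q$ elements. A central arrangement $\mathcal{A}$ is a finite collection of linear hyperplanes in a finite dimensional vector space $V$. Its intersection lattice is $L(\mathcal{A})=\{\bigcap_{H\in\mathcal{B}}H \mid \mathcal{B}\subseteq\mathcal{A}\}$ (the empty intersection being $V$), ordered by reverse inclusion, and its characteristic polynomial is $\chi(\mathcal{A},t)=\sum_{X\in L(\mathcal{A})}\mu(X)t^{\dim X}$, where $\mu(X)=\mu(V,X)$ is the Möbius function of $L(\mathcal{A})$. For a simple graph $G$ on $[\ell]$, the $q$-deformation of the graphical arrangement is the arrangement in $\mathbb{F}_q^\ell$ (with coordinates $x_1,\dots,x_\ell$) $$\mathcal{A}_G^q=\bigcup_{\{i_1,\dots,i_r\}}\Big\{\{a_{i_1}x_{i_1}+\dots+a_{i_r}x_{i_r}=0\}\ \Big|\ (a_{i_1},\dots,a_{i_r})\in\mathbb{F}_q^r\setminus\{0\}\Big\},$$ where $\{i_1,\dots,i_r\}$ runs over all nonempty cliques of $G$ (sets of pairwise adjacent vertices, including single vertices). The polynomials $t_q^{\underline{i}}$ are defined by $t_q^{\underline{i}}=(t-1)(t-q)\cdots(t-q^{i-1})$,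 with $t_q^{\underline{0}}=1$. A stable partition of $G$ is a set partition of the vertex set into nonempty blocks such that no edge of $G$ connects two vertices in the same block. *)

theory Defs
  imports
    Complex_Main
    "HOL-Library.Function_Algebras"
    "HOL-Library.Disjoint_Sets"
    "HOL-Library.Cardinality"
    "HOL-Computational_Algebra.Polynomial"
    "HOL-Number_Theory.Cong"
begin

section \<open>Hyperplane arrangements and their characteristic polynomial\<close>

text \<open>
  The Moebius function \<open>\<mu>(X, Z)\<close> of a finite family \<open>L\<close> of sets ordered by \<^emph>\<open>reverse\<close>
  inclusion, for \<open>X\<close> and \<open>Z\<close> in \<open>L\<close>: it is \<open>1\<close> if \<open>X = Z\<close>, it satisfies
  \<open>\<mu>(X, Z) = - (\<Sum>X \<le> Y < Z. \<mu>(X, Y))\<close> if \<open>X < Z\<close>, and it is \<open>0\<close> if \<open>X \<le> Z\<close> fails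
  (the sum below is then empty).  The value \<open>0\<close> for infinite \<open>L\<close> is a dummy that makes the
  recursion terminate.
\<close>

function moebius :: "'b set set \<Rightarrow> 'b set \<Rightarrow> 'b set \<Rightarrow> int" where
  "moebius L X Z =
     (if infinite L then 0
      else if X = Z then 1
      else - (\<Sum>Y \<in> {Y \<in> L. Y \<subseteq> X \<and> Z \<subset> Y}. moebius L X Y))"
  by pat_completeness auto
termination
proof (relation "measure (\<lambda>(L, X, Z). card {W \<in> L. Z \<subset> W})", goal_cases)
  case (2 L X Z Y)
  then have "{W \<in> L. Y \<subset> W} \<subset> {W \<in> L. Z \<subset> W}" "finite {W \<in> L. Z \<subset> W}"
    by auto
  then show ?case
    by (simp add: psubset_card_mono)
qed simp

declare moebius.simps [simp del]

definition intersection_lattice :: "'b set \<Rightarrow> 'b set set \<Rightarrow> 'b set set" where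
  "intersection_lattice V A = {V \<inter> \<Inter>B | B. B \<subseteq> A}"

text \<open>
  Here \<open>V\<close> is a finite-dimensional subspace of the ambient type and \<open>A\<close> a finite set of
  linear hyperplanes of \<open>V\<close>.
\<close>

definition (in vector_space) char_poly :: "'b set \<Rightarrow> 'b set set \<Rightarrow> int poly" where
  "char_poly V A =
     (\<Sum>X \<in> intersection_lattice V A. monom (moebius (intersection_lattice V A) V X) (dim X))"


section \<open>The coordinate space\<close>

definition scale_fun :: "'a::field \<Rightarrow> (nat \<Rightarrow> 'a) \<Rightarrow> (nat \<Rightarrow> 'a)" where
  "scale_fun c x = (\<lambda>i. c * x i)"

interpretation fun_vs: vector_space "scale_fun :: 'a::field \<Rightarrow> _"
  by unfold_locales (auto simp: scale_fun_def fun_eq_iff algebra_simps)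

text \<open>
  The space of vectors \<open>(x\<^sub>1, \<dots>, x\<^sub>l)\<close>, realised as the functions on \<open>nat\<close> that vanish outside
  the index set \<open>{1..l}\<close>.
\<close>

definition coord_space :: "nat \<Rightarrow> (nat \<Rightarrow> 'a::field) set" where
  "coord_space l = {x. \<forall>i. i \<notin> {1..l} \<longrightarrow> x i = 0}"


section \<open>Graphs\<close>

definition simple_graph :: "'v set \<Rightarrow> 'v set set \<Rightarrow> bool" where
  "simple_graph V E \<longleftrightarrow> (\<forall>e\<in>E. e \<subseteq> V \<and> card e = 2)"

definition clique :: "'v set \<Rightarrow> 'v set set \<Rightarrow> 'v set \<Rightarrow> bool" where
  "clique V E S \<longleftrightarrow> S \<subseteq> V \<and> (\<forall>u\<in>S. \<forall>v\<in>S. u \<noteq> v \<longrightarrow> {u, v} \<in> E)"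

definition stable_partition :: "'v set \<Rightarrow> 'v set set \<Rightarrow> 'v set set \<Rightarrow> bool" where
  "stable_partition V E P \<longleftrightarrow>
     partition_on V P \<and> (\<forall>B\<in>P. \<forall>u\<in>B. \<forall>v\<in>B. {u, v} \<notin> E)"


section \<open>The q-deformation of a graphical arrangement\<close>

text \<open>The number \<open>q\<close> is \<open>CARD('a)\<close> for the finite field \<open>'a\<close>, hence a prime power.\<close>

definition q_graphical_arrangement ::
    "nat \<Rightarrow> nat set set \<Rightarrow> (nat \<Rightarrow> 'a::{field,finite}) set set" where
  "q_graphical_arrangement l E =
     {{x \<in> coord_space l. (\<Sum>i\<in>S. a i * x i) = 0} | S a.
        clique {1..l} E S \<and> S \<noteq> {} \<and> (\<exists>i\<in>S. a i \<noteq> 0)}"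

definition q_falling :: "nat \<Rightarrow> nat \<Rightarrow> 'r::comm_ring_1 poly" where
  "q_falling q i = (\<Prod>j<i. [:- (of_nat q ^ j), 1:])"

end

theory Submission imports Defs begin

text \<open>
  Let \<open>F\<close> be the field with \<open>q\<close> elements.  The key is an interpretation of the coefficients:
  \<open>c\<^sub>i\<close> is the number of \<open>i\<close>-dimensional subspaces of \<open>F\<^sup>l\<close> that lie in no hyperplane of the arrangement
  (\<open>char_poly_q_falling_expansion\<close>).  It comes from the identity \<open>t\<^bsup>dim X\<^esup> = (\<Sum>W \<le> X. (t - 1)(t - q)\<dots>)\<close>,
  the product having \<open>dim W\<close> factors, over the subspaces \<open>W\<close> of a space \<open>X\<close>
  (\<open>sum_q_falling_subspaces\<close>).  At \<open>t = q\<^sup>k\<close> it sorts the \<open>k\<close>-tuples of vectors of \<open>X\<close> by their span.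
  Insert it for every flat \<open>X\<close> and exchange the sums: \<open>W\<close> gets the weight \<open>\<Sum>\<mu>(X)\<close> over the flats
  \<open>X\<close> containing \<open>W\<close>.  These flats form an interval of the intersection lattice, so the weight is \<open>0\<close> unless
  no hyperplane contains \<open>W\<close> (\<open>sum_moebius_above\<close>).
  
  The torus of diagonal matrices with nonzero entries permutes these subspaces \<open>W\<close>, and their orbits give the divisibility.
  Since single vertices are cliques, no coordinate vanishes on \<open>W\<close>.  Choose \<open>i = dim W\<close> coordinates
  \<open>P\<close> that identify \<open>W\<close> with \<open>F\<^sup>P\<close>, and let \<open>w\<^sub>p\<close> be the basis of \<open>W\<close> dual to them.  A
  diagonal matrix that fixes \<open>W\<close> has every \<open>w\<^sub>p\<close> as an eigenvector, so its entries agree on the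
  support of \<open>w\<^sub>p\<close>.  There are two cases (\<open>stretched_block_space_or_free_subtorus\<close>).
  
    \<^item> The supports of the \<open>w\<^sub>p\<close> are disjoint.  They form a partition of the vertex set into \<open>i\<close> blocks, and
      \<open>W\<close> is in the torus orbit of the space of vectors that are constant on the blocks.  This space
      lies in no hyperplane iff the partition is stable, its orbit has \<open>(q - 1)\<^bsup>l - i\<^esup>\<close> elements, and
      the orbit determines the partition.
  
    \<^item> The supports of \<open>w\<^sub>p\<close> and \<open>w\<^sub>p'\<close> overlap for some \<open>p \<noteq> p'\<close>.  Then the torus on the coordinates
      outside \<open>P - {p'}\<close> acts freely on the orbit of \<open>W\<close>, whose size is therefore a multiple of
      \<open>(q - 1)\<^bsup>l - i + 1\<^esup>\<close>.
  
  Hence \<open>c\<^sub>i = (q - 1)\<^bsup>l - i\<^esup> (s\<^sub>i + (q - 1) z)\<close>, with \<open>s\<^sub>i\<close> the number of stable partitions into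
  \<open>i\<close> blocks (\<open>card_avoiding_subspaces\<close>).  The \<open>q\<close>-falling powers have distinct degrees, so no other coefficients are possible.
\<close>

section \<open>Subspaces of a vector space over a finite field\<close>

lemma q_falling_Suc:
  "q_falling q (Suc i) = q_falling q i * [:- (of_nat q ^ i), 1:]"
  by (simp add: q_falling_def)

lemma field_card_ge_2: "2 \<le> CARD('a::{field,finite})"
  using card_mono[of "UNIV :: 'a set" "{0, 1}"] by simp

locale finite_field_space = vector_space scale
  for scale :: "'a::{field,finite} \<Rightarrow> 'b::ab_group_add \<Rightarrow> 'b"
begin

abbreviation (input) subspaces_in :: "'b set \<Rightarrow> 'b set set" where
  "subspaces_in X \<equiv> {W. subspace W \<and> W \<subseteq> X}"

lemma inj_on_add_line:
  assumes "subspace W" "e \<notin> W"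
  shows "inj_on (\<lambda>(x, c). x + scale c e) (W \<times> UNIV)"
proof (rule inj_onI, clarify)
  fix x c y d
  assume x: "x \<in> W" "y \<in> W" and eq: "x + scale c e = y + scale d e"
  have "scale (c - d) e = y - x"
    using eq by (simp add: scale_left_diff_distrib algebra_simps)
  then have *: "scale (c - d) e \<in> W"
    using x assms(1) by (simp add: subspace_diff)
  have "c = d"
  proof (rule ccontr)
    assume "c \<noteq> d"
    have "scale (inverse (c - d)) (scale (c - d) e) \<in> W"
      using * assms(1) by (rule subspace_scale[rotated])
    then show False using \<open>c \<noteq> d\<close> assms(2) by simp
  qed
  then show "x = y \<and> c = d" using eq by simp
qed

lemma mem_span_insert_iff:
  assumes "subspace W"
  shows "x \<in> span (insert e W) \<longleftrightarrow> (\<exists>w\<in>W. \<exists>c. x = w + scale c e)"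
proof -
  have "x \<in> span (insert e W) \<longleftrightarrow> (\<exists>c. x - scale c e \<in> W)"
    using assms by (simp add: span_insert span_eq_iff[THEN iffD2])
  also have "\<dots> \<longleftrightarrow> (\<exists>w\<in>W. \<exists>c. x = w + scale c e)"
    by (metis add_diff_cancel diff_add_cancel)
  finally show ?thesis .
qed

lemma span_insert_subspace:
  assumes "subspace W"
  shows "span (insert e W) = (\<lambda>(x, c). x + scale c e) ` (W \<times> UNIV)"
  using mem_span_insert_iff[OF assms] by (auto simp: set_eq_iff image_iff)

lemma card_span_insert:
  assumes "subspace W" "e \<notin> W"
  shows "card (span (insert e W)) = CARD('a) * card W"
  using card_image[OF inj_on_add_line[OF assms]]
  by (simp add: span_insert_subspace[OF assms(1)] card_cartesian_product)

lemma card_span_independent: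
  assumes "finite B" "independent B"
  shows "finite (span B) \<and> card (span B) = CARD('a) ^ card B"
  using assms
proof (induction B)
  case (insert b B)
  then have b: "b \<notin> span B" and B: "independent B"
    by (auto simp: independent_insert)
  have eq: "span (insert b (span B)) = span (insert b B)"
    by (metis (no_types) span_insert span_span)
  show ?case
    using insert.IH[OF B] insert.hyps card_span_insert[OF subspace_span b]
      span_insert_subspace[OF subspace_span, of b B]
    by (simp add: eq)
qed simp

lemma card_subspace:
  assumes "subspace W" "finite W"
  shows "card W = CARD('a) ^ dim W"
proof -
  obtain B where B: "B \<subseteq> W" "independent B" "W \<subseteq> span B" "card B = dim W"
    using basis_exists by blast
  then have "span B = W" using assms(1) by (simp add: span_subspace)
  moreover have "finite B" using B(1) assms(2) finite_subset by blast
  ultimately show ?thesis using card_span_independent B by metis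
qed

lemma dim_eq_iff_card:
  assumes "subspace W" "finite W"
  shows "dim W = n \<longleftrightarrow> card W = CARD('a) ^ n"
  using card_subspace[OF assms] field_card_ge_2[where 'a = 'a] by (auto simp: power_inject_exp)

lemma finite_span_insert:
  assumes "subspace W" "finite W"
  shows "finite (span (insert e W))"
  using assms by (simp add: span_insert_subspace)

lemma dim_span_insert:
  assumes "subspace W" "finite W" "e \<notin> W"
  shows "dim (span (insert e W)) = Suc (dim W)"
  using card_span_insert[OF assms(1,3)] card_subspace[OF assms(1,2)]
    dim_eq_iff_card[OF subspace_span finite_span_insert[OF assms(1,2)]] by simp

text \<open>
  The identity \<open>t\<^bsup>dim X\<^esup> = (\<Sum>W \<le> X. (t - 1)(t - q)\<dots>)\<close> is proved by induction on \<open>dim X\<close>.  For the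
  step from \<open>X\<close> to \<open>X \<oplus> \<langle>e\<rangle>\<close>, subspaces are grouped by their image under the projection to \<open>X\<close> along
  \<open>e\<close>, the shadow.  The subspaces with shadow \<open>W\<close> are \<open>W \<oplus> \<langle>e\<rangle>\<close> and, if \<open>e\<close> is not contained, the graphs of
  the linear forms on \<open>W\<close>, which are given by arbitrary values on a basis.
\<close>

definition shadow :: "'b \<Rightarrow> 'b set \<Rightarrow> 'b set \<Rightarrow> 'b set" where
  "shadow e X U = {x \<in> X. \<exists>c. x + scale c e \<in> U}"

definition linear_form :: "'b set \<Rightarrow> ('b \<Rightarrow> 'a) \<Rightarrow> 'b \<Rightarrow> 'a" where
  "linear_form B c x = (\<Sum>b\<in>B. c b * representation B x b)"

definition form_graph :: "'b \<Rightarrow> 'b set \<Rightarrow> ('b \<Rightarrow> 'a) \<Rightarrow> 'b set" where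
  "form_graph e B c = (\<lambda>x. x + scale (linear_form B c x) e) ` span B"

lemma linear_form_add:
  assumes "independent B" "x \<in> span B" "y \<in> span B"
  shows "linear_form B c (x + y) = linear_form B c x + linear_form B c y"
  using assms by (simp add: linear_form_def representation_add distrib_left sum.distrib)

lemma linear_form_scale:
  assumes "independent B" "x \<in> span B"
  shows "linear_form B c (scale r x) = r * linear_form B c x"
  using assms by (simp add: linear_form_def representation_scale sum_distrib_left mult_ac)

lemma linear_form_basis:
  assumes "independent B" "finite B" "b \<in> B"
  shows "linear_form B c b = c b"
  using assms by (simp add: linear_form_def representation_basis if_distrib sum.delta cong: if_cong)

lemma subspace_shadow:
  assumes "subspace X" "subspace U"
  shows "subspace (shadow e X U)"
proof (rule subspaceI)
  have "0 + scale 0 e \<in> U" using assms(2) by (simp add: subspace_0)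
  then show "0 \<in> shadow e X U"
    using assms(1) unfolding shadow_def by (blast intro: subspace_0)
next
  fix x y assume "x \<in> shadow e X U" "y \<in> shadow e X U"
  then obtain c d where *: "x \<in> X" "y \<in> X" "x + scale c e \<in> U" "y + scale d e \<in> U"
    by (auto simp: shadow_def)
  then have "(x + scale c e) + (y + scale d e) \<in> U" using assms(2) by (blast intro: subspace_add)
  then have "(x + y) + scale (c + d) e \<in> U" by (simp add: scale_left_distrib add_ac)
  then show "x + y \<in> shadow e X U"
    using * assms(1) unfolding shadow_def by (blast intro: subspace_add)
next
  fix r x assume "x \<in> shadow e X U"
  then obtain c where *: "x \<in> X" "x + scale c e \<in> U"
    by (auto simp: shadow_def)
  then have "scale r (x + scale c e) \<in> U" using assms(2) by (blast intro: subspace_scale)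
  then have "scale r x + scale (r * c) e \<in> U" by (simp add: scale_right_distrib)
  then show "scale r x \<in> shadow e X U"
    using * assms(1) unfolding shadow_def by (blast intro: subspace_scale)
qed

lemma subspace_form_graph:
  assumes "independent B"
  shows "subspace (form_graph e B c)"
proof (rule subspaceI)
  have "linear_form B c 0 = 0" using linear_form_scale[OF assms span_zero, of c 0] by simp
  then show "0 \<in> form_graph e B c"
    unfolding form_graph_def by (auto intro!: image_eqI[of _ _ 0] span_zero)
next
  fix x y assume "x \<in> form_graph e B c" "y \<in> form_graph e B c"
  then obtain u v where *: "u \<in> span B" "v \<in> span B" "x = u + scale (linear_form B c u) e"
    "y = v + scale (linear_form B c v) e"
    by (auto simp: form_graph_def)
  then have "x + y = (u + v) + scale (linear_form B c (u + v)) e"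
    by (simp add: linear_form_add[OF assms] scale_left_distrib add_ac)
  then show "x + y \<in> form_graph e B c"
    unfolding form_graph_def using * by (blast intro: span_add)
next
  fix r x assume "x \<in> form_graph e B c"
  then obtain u where *: "u \<in> span B" "x = u + scale (linear_form B c u) e"
    by (auto simp: form_graph_def)
  then have "scale r x = scale r u + scale (linear_form B c (scale r u)) e"
    by (simp add: linear_form_scale[OF assms] scale_right_distrib)
  then show "scale r x \<in> form_graph e B c"
    unfolding form_graph_def using * by (blast intro: span_scale)
qed

lemma mem_form_graph_iff:
  assumes "independent B" "e \<notin> X" "subspace X" "B \<subseteq> X" "x \<in> X"
  shows "x + scale d e \<in> form_graph e B c \<longleftrightarrow> x \<in> span B \<and> d = linear_form B c x"
proof
  assume "x + scale d e \<in> form_graph e B c"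
  then obtain u where u: "u \<in> span B" "x + scale d e = u + scale (linear_form B c u) e"
    by (auto simp: form_graph_def)
  have "u \<in> X" using u(1) assms(3,4) span_minimal by blast
  then have "(x, d) = (u, linear_form B c u)"
    using inj_onD[OF inj_on_add_line[OF assms(3,2)], of "(x, d)" "(u, linear_form B c u)"] u assms(5)
    by simp
  then show "x \<in> span B \<and> d = linear_form B c x" using u by simp
qed (auto simp: form_graph_def)

text \<open>
  If \<open>U\<close> does not contain \<open>e\<close>, then every vector of its shadow has exactly one lift to \<open>U\<close>, and the
  \<open>e\<close>-component of the lift is a linear form.
\<close>

lemma subspaces_over_shadow_avoiding:
  assumes X: "subspace X" "finite X" "e \<notin> X"
    and B: "independent B" "B \<subseteq> X"
  shows "bij_betw (form_graph e B) (B \<rightarrow>\<^sub>E UNIV)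
     {U \<in> subspaces_in (span (insert e X)). shadow e X U = span B \<and> e \<notin> U}" (is "bij_betw _ _ ?T")
proof (rule bij_betw_imageI)
  have finB: "finite B" using B(2) X(2) finite_subset by blast
  have BX: "span B \<subseteq> X" using B(2) X(1) by (simp add: span_minimal)
  have mem: "x + scale d e \<in> form_graph e B c \<longleftrightarrow> x \<in> span B \<and> d = linear_form B c x"
    if "x \<in> X" for x d c
    using mem_form_graph_iff[OF B(1) X(3,1) B(2) that] .
  show "inj_on (form_graph e B) (B \<rightarrow>\<^sub>E UNIV)"
  proof (rule inj_onI)
    fix c d assume cd: "c \<in> B \<rightarrow>\<^sub>E UNIV" "d \<in> B \<rightarrow>\<^sub>E UNIV" "form_graph e B c = form_graph e B d"
    have "c b = d b" if "b \<in> B" for b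
      using mem[of b "c b" c] mem[of b "c b" d] cd(3) that B(2)
      by (auto simp: linear_form_basis[OF B(1) finB that] span_base)
    then show "c = d" using cd(1,2) by (auto intro: PiE_ext)
  qed
  show "form_graph e B ` (B \<rightarrow>\<^sub>E UNIV) = ?T"
  proof (intro equalityI subsetI)
    fix U assume "U \<in> form_graph e B ` (B \<rightarrow>\<^sub>E UNIV)"
    then obtain c where U: "U = form_graph e B c" by blast
    have "U \<subseteq> span (insert e X)"
      using BX unfolding U form_graph_def span_insert_subspace[OF X(1)] by auto
    moreover have "shadow e X U = span B"
      using BX by (auto simp: shadow_def U mem)
    moreover have "e \<notin> U"
    proof
      assume "e \<in> U"
      then have "0 + scale 1 e \<in> form_graph e B c" by (simp add: U)
      then have "1 = linear_form B c 0" using mem[of 0 1 c] subspace_0[OF X(1)] by blast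
      then show False using linear_form_scale[OF B(1) span_zero, of c 0] by simp
    qed
    ultimately show "U \<in> ?T" using subspace_form_graph[OF B(1)] by (simp add: U)
  next
    fix U assume U: "U \<in> ?T"
    then have sU: "subspace U" by blast
    have uniq: "d = d'" if "x + scale d e \<in> U" "x + scale d' e \<in> U" for x d d'
    proof (rule ccontr)
      assume "d \<noteq> d'"
      have "(x + scale d e) - (x + scale d' e) \<in> U" using that sU by (blast intro: subspace_diff)
      then have "scale (d - d') e \<in> U" by (simp add: scale_left_diff_distrib)
      then have "scale (inverse (d - d')) (scale (d - d') e) \<in> U" using sU by (blast intro: subspace_scale)
      then show False using U \<open>d \<noteq> d'\<close> by simp
    qed
    have "\<exists>d. b + scale d e \<in> U" if "b \<in> B" for b
      using U that span_base[of b B] by (auto simp: shadow_def)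
    then obtain c0 where c0: "\<And>b. b \<in> B \<Longrightarrow> b + scale (c0 b) e \<in> U" by metis
    define c where "c = restrict c0 B"
    have c: "b + scale (c b) e \<in> U" if "b \<in> B" for b using c0[OF that] that by (simp add: c_def)
    have lift: "x + scale (linear_form B c x) e \<in> U" if "x \<in> span B" for x
    proof -
      have "(\<Sum>b\<in>B. scale (representation B x b) (b + scale (c b) e)) \<in> U"
        using c sU by (intro subspace_sum subspace_scale) auto
      moreover have "(\<Sum>b\<in>B. scale (representation B x b) b) = x"
        using sum_representation_eq[OF B(1) that finB] by simp
      ultimately show ?thesis
        by (simp add: scale_right_distrib sum.distrib linear_form_def scale_sum_left mult.commute)
    qed
    have "U = form_graph e B c"
    proof (intro equalityI subsetI)
      fix u assume u: "u \<in> U"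
      then obtain x d where x: "x \<in> X" "u = x + scale d e"
        using U mem_span_insert_iff[OF X(1), of u e] by blast
      then have "x \<in> span B" using U u by (auto simp: shadow_def)
      then show "u \<in> form_graph e B c"
        using uniq[of x d "linear_form B c x"] lift u x by (auto simp: form_graph_def)
    qed (use lift in \<open>auto simp: form_graph_def\<close>)
    moreover have "c \<in> B \<rightarrow>\<^sub>E UNIV" by (simp add: c_def)
    ultimately show "U \<in> form_graph e B ` (B \<rightarrow>\<^sub>E UNIV)" by blast
  qed
qed

lemma subspaces_over_shadow_containing:
  assumes X: "subspace X" "e \<notin> X" and W: "subspace W" "W \<subseteq> X"
  shows "{U \<in> subspaces_in (span (insert e X)). shadow e X U = W \<and> e \<in> U} = {span (insert e W)}"
proof (intro equalityI subsetI)
  fix U assume U: "U \<in> {U \<in> subspaces_in (span (insert e X)). shadow e X U = W \<and> e \<in> U}"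
  then have sU: "subspace U" by simp
  have "u \<in> span (insert e W)" if "u \<in> U" for u
  proof -
    obtain x d where "x \<in> X" "u = x + scale d e"
      using U \<open>u \<in> U\<close> mem_span_insert_iff[OF X(1), of u e] by blast
    moreover from this have "x \<in> W" using U that by (auto simp: shadow_def)
    ultimately show ?thesis by (auto simp: span_insert_subspace[OF W(1)])
  qed
  moreover have "W \<subseteq> U"
  proof
    fix x assume "x \<in> W"
    then obtain c where "x + scale c e \<in> U" using U by (auto simp: shadow_def)
    then have "(x + scale c e) - scale c e \<in> U" using U sU by (blast intro: subspace_diff subspace_scale)
    then show "x \<in> U" by simp
  qed
  then have "span (insert e W) \<subseteq> U" using U sU by (intro span_minimal) auto
  ultimately show "U \<in> {span (insert e W)}" by auto
next
  fix U assume "U \<in> {span (insert e W)}"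
  then have U: "U = span (insert e W)" by simp
  have "x + scale c e \<in> U \<longleftrightarrow> x \<in> W" if "x \<in> X" for x c
  proof
    assume "x + scale c e \<in> U"
    then obtain w d where w: "w \<in> W" "x + scale c e = w + scale d e"
      by (auto simp: U span_insert_subspace[OF W(1)])
    then have "(x, c) = (w, d)"
      using inj_onD[OF inj_on_add_line[OF X], of "(x, c)" "(w, d)"] that W by auto
    then show "x \<in> W" using w by simp
  qed (auto simp: U span_insert_subspace[OF W(1)])
  then have "shadow e X U = W" using W(2) by (auto simp: shadow_def)
  moreover have "U \<subseteq> span (insert e X)" using W(2) unfolding U by (intro span_mono) auto
  ultimately show "U \<in> {U \<in> subspaces_in (span (insert e X)). shadow e X U = W \<and> e \<in> U}"
    by (simp add: U span_base)
qed

text \<open>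
  With \<open>i = dim W\<close> and \<open>f\<^sub>i\<close> the \<open>i\<close>-th falling power, the \<open>q\<^sup>i\<close> graphs and the space \<open>W \<oplus> \<langle>e\<rangle>\<close>
  contribute \<open>q\<^sup>i f\<^sub>i + f\<^bsub>i+1\<^esub> = t f\<^sub>i\<close>.
\<close>

lemma sum_q_falling_over_shadow:
  assumes X: "subspace X" "finite X" "e \<notin> X" and W: "subspace W" "W \<subseteq> X"
  shows "(\<Sum>U | U \<in> subspaces_in (span (insert e X)) \<and> shadow e X U = W. q_falling CARD('a) (dim U))
       = [:0, 1:] * (q_falling CARD('a) (dim W) :: 'r::comm_ring_1 poly)"
proof -
  obtain B where B: "B \<subseteq> W" "independent B" "W \<subseteq> span B" "card B = dim W"
    using basis_exists by blast
  have spB: "span B = W" using B W(1) by (simp add: span_subspace)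
  have BX: "B \<subseteq> X" using B W by blast
  have fin: "finite W" "finite B" using W(2) BX X(2) finite_subset by blast+
  let ?S = "\<lambda>P. {U \<in> subspaces_in (span (insert e X)). shadow e X U = W \<and> P U}"
  let ?f = "\<lambda>U. q_falling CARD('a) (dim U) :: 'r poly"
  note bij = subspaces_over_shadow_avoiding[OF X B(2) BX, unfolded spB]
  have fE: "finite (subspaces_in (span (insert e X)))"
    using finite_span_insert[OF X(1,2)] by simp
  have dimU: "dim U = dim W" if "U \<in> ?S (\<lambda>U. e \<notin> U)" for U
  proof -
    have "U \<in> form_graph e B ` (B \<rightarrow>\<^sub>E UNIV)"
      using that unfolding bij_betw_imp_surj_on[OF bij] .
    then obtain c where U: "U = form_graph e B c" by (rule imageE)
    have "card U = card W" unfolding U form_graph_def spB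
    proof (rule card_image, rule inj_onI)
      fix x y assume "x \<in> W" "y \<in> W"
        "x + scale (linear_form B c x) e = y + scale (linear_form B c y) e"
      then show "x = y"
        using inj_onD[OF inj_on_add_line[OF X(1,3)], of "(x, linear_form B c x)" "(y, linear_form B c y)"]
          W(2) by auto
    qed
    moreover have "subspace U" "finite U"
      using that finite_span_insert[OF X(1,2)] finite_subset by auto
    ultimately show ?thesis using dim_eq_iff_card card_subspace[OF W(1) fin(1)] by simp
  qed
  have "(\<Sum>U | U \<in> subspaces_in (span (insert e X)) \<and> shadow e X U = W. ?f U)
      = (\<Sum>U \<in> ?S (\<lambda>U. e \<notin> U) \<union> ?S (\<lambda>U. e \<in> U). ?f U)"
    by (rule sum.cong) auto
  also have "\<dots> = (\<Sum>U \<in> ?S (\<lambda>U. e \<notin> U). ?f U) + (\<Sum>U \<in> ?S (\<lambda>U. e \<in> U). ?f U)"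
    by (intro sum.union_disjoint) (auto intro: finite_subset[OF _ fE])
  also have "(\<Sum>U \<in> ?S (\<lambda>U. e \<notin> U). ?f U) = of_nat (CARD('a) ^ dim W) * ?f W"
  proof -
    have "card (?S (\<lambda>U. e \<notin> U)) = CARD('a) ^ dim W"
      using bij_betw_same_card[OF bij] fin(2) B(4) by (simp add: card_funcsetE)
    then show ?thesis using dimU by simp
  qed
  also have "(\<Sum>U \<in> ?S (\<lambda>U. e \<in> U). ?f U) = q_falling CARD('a) (Suc (dim W))"
  proof -
    have "e \<notin> W" using X(3) W(2) by blast
    then show ?thesis
      using dim_span_insert[OF W(1) fin(1)]
      by (simp only: subspaces_over_shadow_containing[OF X(1,3) W]) simp
  qed
  also have "of_nat (CARD('a) ^ dim W) * ?f W + q_falling CARD('a) (Suc (dim W)) = [:0, 1:] * ?f W"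
    by (simp add: q_falling_Suc of_nat_poly algebra_simps)
  finally show ?thesis .
qed

lemma sum_q_falling_span:
  assumes "finite B" "independent B"
  shows "(\<Sum>W \<in> subspaces_in (span B). q_falling CARD('a) (dim W)) = (monom 1 (card B) :: 'r::comm_ring_1 poly)"
  using assms
proof (induction B)
  case empty
  have "subspaces_in (span {}) = {{0}}" by (auto simp: subspace_0)
  moreover have "dim {0} = 0"
    using dim_eq_card_independent[OF independent_empty] dim_span[of "{}"] by simp
  ultimately show ?case by (simp add: q_falling_def)
next
  case (insert e B)
  then have e: "e \<notin> span B" and B: "independent B"
    by (auto simp: independent_insert)
  have eq: "span (insert e (span B)) = span (insert e B)"
    by (metis (no_types) span_insert span_span)
  have fB: "finite (span B)" using card_span_independent insert.hyps B by blast
  let ?f = "\<lambda>U. q_falling CARD('a) (dim U) :: 'r poly"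
  have "(\<Sum>U \<in> subspaces_in (span (insert e B)). ?f U)
     = (\<Sum>W \<in> subspaces_in (span B). \<Sum>U | U \<in> subspaces_in (span (insert e B)) \<and> shadow e (span B) U = W. ?f U)"
    using fB finite_span_insert[OF subspace_span fB, of e]
    by (intro sum.group[symmetric]) (auto simp: eq subspace_shadow, auto simp: shadow_def)
  also have "\<dots> = (\<Sum>W \<in> subspaces_in (span B). [:0, 1:] * ?f W)"
    using sum_q_falling_over_shadow[OF subspace_span fB e, unfolded eq] by (intro sum.cong) auto
  also have "\<dots> = [:0, 1:] * monom 1 (card B)"
    by (simp only: sum_distrib_left[symmetric] insert.IH[OF B])
  also have "\<dots> = monom 1 (card (insert e B))"
    using insert.hyps by (simp add: monom_Suc)
  finally show ?case .
qed

lemma sum_q_falling_subspaces: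
  assumes "subspace X" "finite X"
  shows "(\<Sum>W \<in> subspaces_in X. q_falling CARD('a) (dim W)) = (monom 1 (dim X) :: 'r::comm_ring_1 poly)"
proof -
  obtain B where B: "B \<subseteq> X" "independent B" "X \<subseteq> span B" "card B = dim X"
    using basis_exists by blast
  moreover have "span B = X" using B assms(1) by (simp add: span_subspace)
  moreover have "finite B" using B(1) assms(2) finite_subset by blast
  ultimately show ?thesis using sum_q_falling_span[of B] by simp
qed

end

section \<open>The characteristic polynomial in the basis of q-falling powers\<close>

lemma smult_sum_right: "smult c (\<Sum>x\<in>X. f x) = (\<Sum>x\<in>X. smult c (f x))"
  by (intro poly_eqI) (simp add: coeff_sum sum_distrib_left)

text \<open>
  The flats containing \<open>W\<close> are those containing the smallest one, \<open>Z\<close>, so the sum runs over the whole interval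
  from \<open>V\<close> to \<open>Z\<close>.  The defining recursion of the Moebius function makes it vanish unless \<open>Z = V\<close>.
\<close>

lemma sum_moebius_above:
  assumes fin: "finite A" and W: "W \<subseteq> V"
    and proper: "\<And>H. H \<in> A \<Longrightarrow> \<not> V \<subseteq> H"
  shows "(\<Sum>X | X \<in> intersection_lattice V A \<and> W \<subseteq> X. moebius (intersection_lattice V A) V X)
       = (if \<exists>H\<in>A. W \<subseteq> H then 0 else 1)"
proof -
  let ?L = "intersection_lattice V A"
  define Z where "Z = V \<inter> \<Inter>{H \<in> A. W \<subseteq> H}"
  have L_eq: "?L = (\<lambda>B. V \<inter> \<Inter>B) ` Pow A" by (auto simp: intersection_lattice_def)
  then have finL: "finite ?L" using fin by simp
  have ZL: "Z \<in> ?L" unfolding L_eq Z_def by (intro imageI) auto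
  have XV: "X \<subseteq> V" if "X \<in> ?L" for X using that by (auto simp: L_eq)
  have above: "W \<subseteq> X \<longleftrightarrow> Z \<subseteq> X" if "X \<in> ?L" for X
  proof
    assume "W \<subseteq> X"
    moreover obtain B where B: "B \<subseteq> A" "X = V \<inter> \<Inter>B" using \<open>X \<in> ?L\<close> by (auto simp: L_eq)
    ultimately have "B \<subseteq> {H \<in> A. W \<subseteq> H}" by blast
    then show "Z \<subseteq> X" unfolding Z_def B(2) by blast
  qed (use W in \<open>auto simp: Z_def\<close>)
  have eq: "{X. X \<in> ?L \<and> W \<subseteq> X} = {X \<in> ?L. Z \<subseteq> X}" using above by blast
  show ?thesis
  proof (cases "\<exists>H\<in>A. W \<subseteq> H")
    case True
    then have "Z \<noteq> V" using proper by (auto simp: Z_def)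
    have "{X \<in> ?L. Z \<subseteq> X} = insert Z {Y \<in> ?L. Y \<subseteq> V \<and> Z \<subset> Y}" using ZL XV by auto
    then have "(\<Sum>X \<in> {X \<in> ?L. Z \<subseteq> X}. moebius ?L V X)
        = moebius ?L V Z + (\<Sum>Y \<in> {Y \<in> ?L. Y \<subseteq> V \<and> Z \<subset> Y}. moebius ?L V Y)"
      using finL by simp
    also have "\<dots> = 0"
      using finL \<open>Z \<noteq> V\<close> by (subst moebius.simps) auto
    finally show ?thesis using True eq by simp
  next
    case False
    then have none: "{H \<in> A. W \<subseteq> H} = {}" by blast
    have "Z = V" unfolding Z_def none by simp
    then have "{X \<in> ?L. Z \<subseteq> X} = {V}" using ZL XV by blast
    then show ?thesis using eq False finL by (simp add: moebius.simps)
  qed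
qed

context finite_field_space
begin

lemma char_poly_q_falling_expansion:
  assumes V: "subspace V" "finite V"
    and A: "finite A" "\<And>H. H \<in> A \<Longrightarrow> subspace H" "\<And>H. H \<in> A \<Longrightarrow> \<not> V \<subseteq> H"
  shows "char_poly V A =
    (\<Sum>W | W \<in> subspaces_in V \<and> (\<forall>H\<in>A. \<not> W \<subseteq> H). q_falling CARD('a) (dim W))"
proof -
  let ?L = "intersection_lattice V A"
  let ?\<mu> = "moebius ?L V"
  let ?f = "\<lambda>W. q_falling CARD('a) (dim W) :: int poly"
  have L_eq: "?L = (\<lambda>B. V \<inter> \<Inter>B) ` Pow A" by (auto simp: intersection_lattice_def)
  have finL: "finite ?L" using A(1) by (simp add: L_eq)
  have L: "subspace X" "X \<subseteq> V" "finite X" if "X \<in> ?L" for X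
  proof -
    from that obtain B where B: "B \<subseteq> A" "X = V \<inter> \<Inter>B" unfolding L_eq by blast
    show "subspace X" unfolding B(2) using V(1) A(2) B(1)
      by (intro subspace_inter subspace_Inter) auto
    show "X \<subseteq> V" "finite X" using B(2) V(2) by auto
  qed
  have finS: "finite (subspaces_in V)" using V(2) by simp
  have "char_poly V A = (\<Sum>X\<in>?L. smult (?\<mu> X) (monom 1 (dim X)))"
    by (simp add: char_poly_def smult_monom)
  also have "\<dots> = (\<Sum>X\<in>?L. smult (?\<mu> X) (\<Sum>W \<in> subspaces_in X. ?f W))"
    using sum_q_falling_subspaces[OF L(1,3), where 'r = int] by simp
  also have "\<dots> = (\<Sum>X\<in>?L. \<Sum>W | W \<in> subspaces_in V \<and> W \<subseteq> X. smult (?\<mu> X) (?f W))"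
  proof (rule sum.cong)
    fix X assume "X \<in> ?L"
    then have "subspaces_in X = {W \<in> subspaces_in V. W \<subseteq> X}" using L(2) by blast
    then show "smult (?\<mu> X) (\<Sum>W \<in> subspaces_in X. ?f W)
        = (\<Sum>W | W \<in> subspaces_in V \<and> W \<subseteq> X. smult (?\<mu> X) (?f W))"
      by (simp add: smult_sum_right)
  qed simp
  also have "\<dots> = (\<Sum>W \<in> subspaces_in V. \<Sum>X | X \<in> ?L \<and> W \<subseteq> X. smult (?\<mu> X) (?f W))"
    by (rule sum.swap_restrict[OF finL finS])
  also have "\<dots> = (\<Sum>W \<in> subspaces_in V. smult (\<Sum>X | X \<in> ?L \<and> W \<subseteq> X. ?\<mu> X) (?f W))"
    by (simp add: smult_sum)
  also have "\<dots> = (\<Sum>W \<in> subspaces_in V. smult (if \<exists>H\<in>A. W \<subseteq> H then 0 else 1) (?f W))"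
    using sum_moebius_above[OF A(1) _ A(3)] by (intro sum.cong) auto
  also have "\<dots> = (\<Sum>W | W \<in> subspaces_in V \<and> (\<forall>H\<in>A. \<not> W \<subseteq> H). ?f W)"
    using finS by (intro sum.mono_neutral_cong_right) auto
  finally show ?thesis .
qed

end

lemma degree_q_falling: "degree (q_falling q i :: 'r::idom poly) = i"
proof (induction i)
  case (Suc i)
  have "q_falling q i \<noteq> (0 :: 'r poly)" by (simp add: q_falling_def)
  then have "degree (q_falling q (Suc i) :: 'r poly) = degree (q_falling q i :: 'r poly) + degree [:- (of_nat q ^ i), 1::'r:]"
    unfolding q_falling_Suc by (intro degree_mult_eq) auto
  then show ?case by (simp add: Suc.IH)
qed (simp add: q_falling_def)

lemma q_falling_sum_eq_0:
  assumes "(\<Sum>i\<le>n. smult (d i) (q_falling q i)) = (0 :: 'r::idom poly)"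
  shows "i \<le> n \<Longrightarrow> d i = 0"
  using assms
proof (induction n arbitrary: i)
  case 0
  then show ?case by (simp add: q_falling_def)
next
  case (Suc n)
  let ?f = "\<lambda>i. q_falling q i :: 'r poly"
  have low: "coeff (?f i) (Suc n) = 0" if "i \<le> n" for i
    using that by (intro coeff_eq_0) (simp add: degree_q_falling)
  have lead: "coeff (?f (Suc n)) (Suc n) \<noteq> 0"
    by (metis degree_q_falling leading_coeff_0_iff degree_0 nat.distinct(1))
  have "0 = coeff (\<Sum>i\<le>Suc n. smult (d i) (?f i)) (Suc n)" using Suc.prems by simp
  also have "\<dots> = d (Suc n) * coeff (?f (Suc n)) (Suc n)" by (simp add: coeff_sum low)
  finally have top: "d (Suc n) = 0" using lead by simp
  then have "(\<Sum>i\<le>n. smult (d i) (?f i)) = 0" using Suc.prems(2) by simp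
  then have "d i = 0" if "i \<le> n" using Suc.IH that by blast
  then show ?case using top Suc.prems(1) by (metis le_Suc_eq)
qed

lemma q_falling_expansion_unique:
  assumes "(\<Sum>i\<le>n. smult (c i) (q_falling q i)) = (\<Sum>i\<le>n. smult (d i) (q_falling q i :: 'r::idom poly))"
    and "i \<le> n"
  shows "c i = d i"
proof -
  have "(\<Sum>i\<le>n. smult (c i - d i) (q_falling q i)) = (0 :: 'r poly)"
    unfolding smult_diff_left sum_subtractf assms(1) by simp
  then show ?thesis using q_falling_sum_eq_0[where d = "\<lambda>i. c i - d i"] assms(2) by simp
qed

lemma map_poly_of_int_q_falling:
  "map_poly of_int (q_falling q i) = (q_falling q i :: 'r::comm_ring_1 poly)"
proof (induction i)
  case (Suc i)
  have "of_int (coeff (q_falling q i) n) = coeff (q_falling q i :: 'r poly) n" for n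
    using arg_cong[OF Suc.IH, of "\<lambda>p. coeff p n"] by (simp add: coeff_map_poly)
  then show ?case
    by (intro poly_eqI) (simp add: q_falling_Suc coeff_map_poly coeff_pCons split: nat.split)
qed (simp add: q_falling_def)

lemma map_poly_of_int_sum:
  "map_poly of_int (\<Sum>x\<in>X. f x) = (\<Sum>x\<in>X. map_poly of_int (f x) :: 'r::comm_ring_1 poly)"
  by (intro poly_eqI) (simp add: coeff_map_poly coeff_sum)

section \<open>The torus of diagonal matrices\<close>

text \<open>
  Both the coordinate space (default value \<open>0\<close>) and the torus below (default value \<open>1\<close>) consist of
  functions on \<open>nat\<close> that are fixed outside a finite set; this lemma lets them be counted.
\<close>

lemma bij_betw_restrict_default:
  "bij_betw (\<lambda>f. restrict f Q) {f. (\<forall>k\<in>Q. f k \<in> S) \<and> (\<forall>k. k \<notin> Q \<longrightarrow> f k = d)} (Q \<rightarrow>\<^sub>E S)"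
proof (rule bij_betw_byWitness[where f' = "\<lambda>f k. if k \<in> Q then f k else d"])
qed (auto simp: fun_eq_iff PiE_def extensional_def)

text \<open>
  Acting on vectors over all of \<open>nat\<close>, the torus on \<open>Q\<close> leaves the other coordinates alone.  Tori
  on different sets \<open>Q\<close> are then subgroups of one group, with pointwise multiplication.
\<close>

definition torus :: "nat set \<Rightarrow> (nat \<Rightarrow> 'a::field) set" where
  "torus Q = {t. (\<forall>k\<in>Q. t k \<in> - {0}) \<and> (\<forall>k. k \<notin> Q \<longrightarrow> t k = 1)}"

definition stretch :: "(nat \<Rightarrow> 'a::field) \<Rightarrow> (nat \<Rightarrow> 'a) set \<Rightarrow> (nat \<Rightarrow> 'a) set" where
  "stretch t W = (*) t ` W"

abbreviation orbit :: "nat set \<Rightarrow> (nat \<Rightarrow> 'a::field) set \<Rightarrow> (nat \<Rightarrow> 'a) set set" where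
  "orbit Q W \<equiv> (\<lambda>t. stretch t W) ` torus Q"

lemma stretchI: "y \<in> W \<Longrightarrow> x = t * y \<Longrightarrow> x \<in> stretch t W"
  by (simp add: stretch_def)

lemma torus_nonzero: "t \<in> torus Q \<Longrightarrow> t k \<noteq> 0"
  by (cases "k \<in> Q") (auto simp: torus_def)

lemma torus_mono: "Q \<subseteq> Q' \<Longrightarrow> torus Q \<subseteq> torus Q'"
  by (auto simp: torus_def)

lemma one_in_torus: "1 \<in> torus Q"
  by (simp add: torus_def)

lemma mult_in_torus: "s \<in> torus Q \<Longrightarrow> t \<in> torus Q \<Longrightarrow> s * t \<in> torus Q"
  by (auto simp: torus_def)

lemma inverse_in_torus: "t \<in> torus Q \<Longrightarrow> (\<lambda>k. inverse (t k)) \<in> torus Q"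
  by (auto simp: torus_def)

lemma torus_inverse_mult: "t \<in> torus Q \<Longrightarrow> (\<lambda>k. inverse (t k)) * t = 1"
  using torus_nonzero by (fastforce simp: fun_eq_iff)

lemma card_torus:
  assumes "finite Q"
  shows "card (torus Q :: (nat \<Rightarrow> 'a::{field,finite}) set) = (CARD('a) - 1) ^ card Q"
  using bij_betw_same_card[OF bij_betw_restrict_default[of Q "- {0::'a}" 1]] assms
  by (simp add: torus_def card_funcsetE Compl_eq_Diff_UNIV card_Diff_subset)

lemma stretch_stretch: "stretch s (stretch t W) = stretch (s * t) W"
  by (simp add: stretch_def image_image mult.assoc)

lemma stretch_one [simp]: "stretch 1 W = W"
  by (simp add: stretch_def)

lemma stretch_inverse: "t \<in> torus Q \<Longrightarrow> stretch (\<lambda>k. inverse (t k)) (stretch t W) = W"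
  by (simp add: stretch_stretch torus_inverse_mult)

lemma dvd_card_by_orbits:
  assumes fin: "finite X"
    and closed: "\<And>t W. t \<in> torus Q \<Longrightarrow> W \<in> X \<Longrightarrow> stretch t W \<in> X"
    and dvd: "\<And>W. W \<in> X \<Longrightarrow> n dvd card (orbit Q W)"
  shows "n dvd card X"
proof -
  have Un: "\<Union>(orbit Q ` X) = X"
  proof
    show "\<Union>(orbit Q ` X) \<subseteq> X" using closed by blast
    show "X \<subseteq> \<Union>(orbit Q ` X)"
    proof
      fix W assume "W \<in> X"
      moreover have "W \<in> orbit Q W" using one_in_torus stretch_one by (metis image_eqI)
      ultimately show "W \<in> \<Union>(orbit Q ` X)" by blast
    qed
  qed
  have sub: "orbit Q W \<subseteq> orbit Q W'" if "orbit Q W \<inter> orbit Q W' \<noteq> {}" for W W' :: "(nat \<Rightarrow> 'a) set"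
  proof
    fix U assume "U \<in> orbit Q W"
    then obtain u where u: "u \<in> torus Q" "U = stretch u W" by blast
    from that obtain s t where st: "s \<in> torus Q" "t \<in> torus Q" "stretch s W = stretch t W'"
      by (auto simp: disjoint_iff)
    let ?s = "\<lambda>k. inverse (s k)"
    have "U = stretch u (stretch ?s (stretch s W))" using u st(1) by (simp add: stretch_inverse)
    also have "\<dots> = stretch (u * (?s * t)) W'" by (simp add: st(3) stretch_stretch)
    finally show "U \<in> orbit Q W'"
      using u st by (blast intro: mult_in_torus inverse_in_torus)
  qed
  have "n dvd card (\<Union>(orbit Q ` X))"
  proof (rule dvd_partition)
    show "finite (\<Union>(orbit Q ` X))" using Un fin by simp
    show "\<forall>Y\<in>orbit Q ` X. n dvd card Y" using dvd by blast
    show "\<forall>Y\<in>orbit Q ` X. \<forall>Y'\<in>orbit Q ` X. Y \<noteq> Y' \<longrightarrow> Y \<inter> Y' = {}"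
    proof (intro ballI impI)
      fix Y Y' assume Y: "Y \<in> orbit Q ` X" "Y' \<in> orbit Q ` X" "Y \<noteq> Y'"
      then obtain W W' where "Y = orbit Q W" "Y' = orbit Q W'" by blast
      then show "Y \<inter> Y' = {}" using sub[of W W'] sub[of W' W] Y(3) by blast
    qed
  qed
  then show ?thesis by (simp add: Un)
qed

lemma inj_on_stretch:
  assumes "\<And>t. t \<in> torus Q \<Longrightarrow> stretch t W = W \<Longrightarrow> t = 1"
  shows "inj_on (\<lambda>t. stretch t W) (torus Q)"
proof (rule inj_onI)
  fix s t assume st: "s \<in> torus Q" "t \<in> torus Q" "stretch s W = stretch t W"
  let ?s = "\<lambda>k. inverse (s k)"
  have "stretch (?s * t) W = W"
    using stretch_inverse[OF st(1), of W] by (simp add: stretch_stretch[symmetric] st(3)[symmetric])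
  then have "?s * t = 1" using assms st by (blast intro: mult_in_torus inverse_in_torus)
  then have "inverse (s k) * t k = 1" for k by (simp add: fun_eq_iff)
  then show "s = t" using torus_nonzero[OF st(1)]
    by (intro ext) (metis inverse_inverse_eq inverse_unique)
qed

text \<open>
  The subtorus \<open>Q\<close> may depend on \<open>W\<close>.  Because the torus is commutative, all members of one orbit have
  the same stabilizer, so \<open>Q\<close> acts freely on the whole \<open>I\<close>-orbit of \<open>W\<close>, which splits into
  \<open>Q\<close>-orbits of full size.
\<close>

lemma dvd_card_of_free_subtori:
  fixes X :: "(nat \<Rightarrow> 'a::{field,finite}) set set"
  assumes fin: "finite X" "finite I"
    and closed: "\<And>t W. t \<in> torus I \<Longrightarrow> W \<in> X \<Longrightarrow> stretch t W \<in> X"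
    and free: "\<And>W. W \<in> X \<Longrightarrow> \<exists>Q\<subseteq>I. card Q = n \<and> (\<forall>t \<in> torus Q. stretch t W = W \<longrightarrow> t = 1)"
  shows "(CARD('a) - 1) ^ n dvd card X"
proof (rule dvd_card_by_orbits[OF fin(1) closed])
  fix W assume W: "W \<in> X"
  obtain Q where Q: "Q \<subseteq> I" "card Q = n" and free_Q: "\<forall>t \<in> torus Q. stretch t W = W \<longrightarrow> t = 1"
    using free[OF W] by (elim exE conjE) (rule that; assumption)
  have finQ: "finite Q" using Q(1) fin(2) finite_subset by blast
  have TQ: "torus Q \<subseteq> (torus I :: (nat \<Rightarrow> 'a) set)" by (rule torus_mono[OF Q(1)])
  show "(CARD('a) - 1) ^ n dvd card (orbit I W)"
  proof (rule dvd_card_by_orbits)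
    show "finite (orbit I W)"
      using closed[OF _ W] by (intro finite_subset[OF _ fin(1)] image_subsetI)
    fix U assume "U \<in> orbit I W"
    then obtain u where u: "u \<in> torus I" "U = stretch u W" by blast
    show "stretch t U' \<in> orbit I W" if "t \<in> torus Q" "U' \<in> orbit I W" for t U'
    proof -
      from that(2) obtain v where v: "v \<in> torus I" "U' = stretch v W" by blast
      then have "t * v \<in> torus I" using that(1) TQ by (blast intro: mult_in_torus)
      then show ?thesis unfolding v(2) stretch_stretch by (rule imageI)
    qed
    have "inj_on (\<lambda>t. stretch t U) (torus Q)"
    proof (rule inj_on_stretch)
      fix t :: "nat \<Rightarrow> 'a" assume t: "t \<in> torus Q" "stretch t U = U"
      let ?u = "\<lambda>k. inverse (u k)"
      have "stretch t W = stretch ?u (stretch u (stretch t W))" using u(1) by (simp add: stretch_inverse)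
      also have "\<dots> = stretch ?u (stretch t U)" by (simp add: u(2) stretch_stretch mult.commute)
      also have "\<dots> = W" unfolding t(2) unfolding u(2) by (rule stretch_inverse[OF u(1)])
      finally show "t = 1" using free_Q t(1) by blast
    qed
    then show "(CARD('a) - 1) ^ n dvd card (orbit Q U)"
      using card_torus[OF finQ, where 'a = 'a] by (simp add: card_image Q(2))
  qed
qed

interpretation fin_vs: finite_field_space "scale_fun :: 'a::{field,finite} \<Rightarrow> _" ..

lemma coord_space_eq: "coord_space l = {x. (\<forall>k\<in>{1..l}. x k \<in> UNIV) \<and> (\<forall>k. k \<notin> {1..l} \<longrightarrow> x k = 0)}"
  by (simp add: coord_space_def)

lemma card_coord_space: "card (coord_space l :: (nat \<Rightarrow> 'a::{field,finite}) set) = CARD('a) ^ l"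
  unfolding coord_space_eq using bij_betw_same_card[OF bij_betw_restrict_default[of "{1..l}" "UNIV::'a set" 0]]
  by (simp add: card_funcsetE)

lemma finite_coord_space: "finite (coord_space l :: (nat \<Rightarrow> 'a::{field,finite}) set)"
  using card_coord_space[of l, where 'a = 'a] by (intro card_ge_0_finite) simp

lemma subspace_coord_space: "fun_vs.subspace (coord_space l)"
  by (auto simp: fun_vs.subspace_def coord_space_def scale_fun_def)

lemma sum_fun_apply: "(\<Sum>x\<in>A. f x) k = (\<Sum>x\<in>A. f x k :: 'b::comm_monoid_add)"
  by (induction A rule: infinite_finite_induct) auto

lemma subspace_stretch:
  assumes "fun_vs.subspace W"
  shows "fun_vs.subspace (stretch t W)"
proof (rule fun_vs.subspaceI)
  show "0 \<in> stretch t W"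
    using fun_vs.subspace_0[OF assms] by (auto simp: stretch_def intro!: image_eqI[of _ _ 0])
next
  fix x y assume "x \<in> stretch t W" "y \<in> stretch t W"
  then obtain u v where "u \<in> W" "v \<in> W" "x = t * u" "y = t * v" by (auto simp: stretch_def)
  then show "x + y \<in> stretch t W"
    using fun_vs.subspace_add[OF assms, of u v]
    by (auto simp: stretch_def fun_eq_iff distrib_left intro!: image_eqI[of _ _ "u + v"])
next
  fix c x assume "x \<in> stretch t W"
  then obtain u where "u \<in> W" "x = t * u" by (auto simp: stretch_def)
  then show "scale_fun c x \<in> stretch t W"
    using fun_vs.subspace_scale[OF assms, of u c]
    by (auto simp: stretch_def fun_eq_iff scale_fun_def intro!: image_eqI[of _ _ "scale_fun c u"])
qed

lemma stretch_subset_coord_space: "W \<subseteq> coord_space l \<Longrightarrow> stretch t W \<subseteq> coord_space l"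
  by (auto simp: stretch_def coord_space_def)

lemma dim_stretch:
  fixes W :: "(nat \<Rightarrow> 'a::{field,finite}) set"
  assumes "fun_vs.subspace W" "finite W" "t \<in> torus Q"
  shows "fun_vs.dim (stretch t W) = fun_vs.dim W"
proof -
  have "inj_on ((*) t) W"
  proof (rule inj_onI)
    fix x y assume "t * x = t * y"
    then have "t k * x k = t k * y k" for k by (simp add: fun_eq_iff)
    then show "x = y" using torus_nonzero[OF assms(3)] by (intro ext) (metis mult_left_cancel)
  qed
  then have "card (stretch t W) = card W" by (simp add: stretch_def card_image)
  moreover have "finite (stretch t W)" using assms(2) by (simp add: stretch_def)
  ultimately show ?thesis
    using fin_vs.dim_eq_iff_card[OF subspace_stretch[OF assms(1)]] fin_vs.card_subspace[OF assms(1,2)] by simp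
qed

text \<open>
  A set \<open>P\<close> of coordinates that is smallest among those on which no nonzero vector of \<open>W\<close> vanishes
  identifies \<open>W\<close> with \<open>F\<^sup>P\<close>: dropping \<open>p\<close> from it admits a nonzero vector that vanishes on the rest of \<open>P\<close>, and its
  multiple with value \<open>1\<close> at \<open>p\<close> is \<open>w p\<close>.
\<close>

lemma coordinate_basis:
  fixes W :: "(nat \<Rightarrow> 'a::{field,finite}) set"
  assumes W: "fun_vs.subspace W" "W \<subseteq> coord_space l"
  obtains P w where "P \<subseteq> {1..l}" "card P = fun_vs.dim W"
    "\<And>p. p \<in> P \<Longrightarrow> w p \<in> W"
    "\<And>p p'. p \<in> P \<Longrightarrow> p' \<in> P \<Longrightarrow> w p p' = (if p = p' then 1 else 0)"
    "\<And>x k. x \<in> W \<Longrightarrow> x k = (\<Sum>p\<in>P. x p * w p k)"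
proof -
  \<comment> \<open>The sets of coordinates that determine a vector of \<open>W\<close>.\<close>
  let ?det = "\<lambda>P. P \<subseteq> {1..l} \<and> (\<forall>x\<in>W. (\<forall>p\<in>P. x p = 0) \<longrightarrow> x = 0)"
  have "?det {1..l}"
  proof (intro conjI ballI impI)
    fix x assume "x \<in> W" "\<forall>p\<in>{1..l}. x p = 0"
    moreover have "\<forall>k. k \<notin> {1..l} \<longrightarrow> x k = 0" using \<open>x \<in> W\<close> W(2) by (auto simp: coord_space_def)
    ultimately show "x = 0" by (metis ext zero_fun_apply)
  qed simp
  then obtain P where P: "?det P" "\<And>P'. ?det P' \<Longrightarrow> card P \<le> card P'"
    using ex_has_least_nat[of ?det "{1..l}" card] by blast
  then have sub: "P \<subseteq> {1..l}" and inj: "\<And>x. x \<in> W \<Longrightarrow> (\<And>p. p \<in> P \<Longrightarrow> x p = 0) \<Longrightarrow> x = 0" by auto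
  have finP: "finite P" using sub finite_subset by blast
  have finW: "finite W" using W(2) finite_coord_space finite_subset by blast
  have "\<exists>y\<in>W. \<forall>p'\<in>P. y p' = (if p = p' then 1 else 0)" if p: "p \<in> P" for p
  proof -
    have "\<not> ?det (P - {p})" using P(2)[of "P - {p}"] p card_Diff1_less[OF finP p] by linarith
    then obtain x where x: "x \<in> W" "\<forall>p'\<in>P - {p}. x p' = 0" "x \<noteq> 0" using sub by blast
    have "x p \<noteq> 0" using inj[OF x(1)] x(2,3) by blast
    then show ?thesis
      using x(1,2) fun_vs.subspace_scale[OF W(1) x(1), of "inverse (x p)"]
      by (intro bexI[of _ "scale_fun (inverse (x p)) x"]) (auto simp: scale_fun_def)
  qed
  then obtain w where w: "\<And>p. p \<in> P \<Longrightarrow> w p \<in> W"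
    "\<And>p p'. p \<in> P \<Longrightarrow> p' \<in> P \<Longrightarrow> w p p' = (if p = p' then 1 else 0)"
    by metis
  have comb: "(\<Sum>p\<in>P. scale_fun (c p) (w p)) \<in> W" for c
    using w(1) W(1) by (intro fun_vs.subspace_sum fun_vs.subspace_scale) auto
  have comb_at: "(\<Sum>p\<in>P. scale_fun (c p) (w p)) p' = c p'" if "p' \<in> P" for c p'
    using finP that by (simp add: sum_fun_apply scale_fun_def w(2) if_distrib sum.delta cong: if_cong)
  have expand: "x = (\<Sum>p\<in>P. scale_fun (x p) (w p))" if "x \<in> W" for x
  proof -
    have "x - (\<Sum>p\<in>P. scale_fun (x p) (w p)) = 0"
      by (rule inj) (auto simp: comb_at intro: fun_vs.subspace_diff[OF W(1) that comb])
    then show ?thesis by simp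
  qed
  have "bij_betw (\<lambda>x. restrict x P) W (P \<rightarrow>\<^sub>E UNIV)"
  proof (rule bij_betw_byWitness[where f' = "\<lambda>c. \<Sum>p\<in>P. scale_fun (c p) (w p)"])
    show "\<forall>x\<in>W. (\<Sum>p\<in>P. scale_fun (restrict x P p) (w p)) = x"
      using expand by simp
    show "\<forall>c \<in> P \<rightarrow>\<^sub>E UNIV. restrict (\<Sum>p\<in>P. scale_fun (c p) (w p)) P = c"
      by (auto simp: fun_eq_iff comb_at PiE_def extensional_def)
  qed (use comb in auto)
  then have "card W = CARD('a) ^ card P"
    using finP by (auto dest!: bij_betw_same_card simp: card_funcsetE)
  then have "card P = fun_vs.dim W" using fin_vs.dim_eq_iff_card[OF W(1) finW] by metis
  moreover have "x k = (\<Sum>p\<in>P. x p * w p k)" if "x \<in> W" for x k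
    using arg_cong[OF expand[OF that], of "\<lambda>f. f k"] by (simp add: sum_fun_apply scale_fun_def)
  ultimately show ?thesis using that[OF sub _ w] by blast
qed

section \<open>Spaces of vectors constant on the blocks of a partition\<close>

definition block_space :: "nat \<Rightarrow> nat set set \<Rightarrow> (nat \<Rightarrow> 'a::field) set" where
  "block_space l \<pi> = {x \<in> coord_space l. \<forall>B\<in>\<pi>. \<forall>j\<in>B. \<forall>k\<in>B. x j = x k}"

lemma block_space_subset: "block_space l \<pi> \<subseteq> coord_space l"
  by (auto simp: block_space_def)

lemma block_spaceI:
  assumes "x \<in> coord_space l" "\<And>B j k. B \<in> \<pi> \<Longrightarrow> j \<in> B \<Longrightarrow> k \<in> B \<Longrightarrow> x j = x k"
  shows "x \<in> block_space l \<pi>"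
  unfolding block_space_def using assms by blast

lemma block_spaceD: "x \<in> block_space l \<pi> \<Longrightarrow> B \<in> \<pi> \<Longrightarrow> j \<in> B \<Longrightarrow> k \<in> B \<Longrightarrow> x j = x k"
  unfolding block_space_def by blast

lemma subspace_block_space: "fun_vs.subspace (block_space l \<pi>)"
proof (rule fun_vs.subspaceI)
  show "0 \<in> block_space l \<pi>"
    by (rule block_spaceI) (simp_all add: fun_vs.subspace_0[OF subspace_coord_space])
next
  fix x y :: "nat \<Rightarrow> 'a" assume xy: "x \<in> block_space l \<pi>" "y \<in> block_space l \<pi>"
  show "x + y \<in> block_space l \<pi>"
  proof (rule block_spaceI)
    show "x + y \<in> coord_space l"
      using xy block_space_subset by (blast intro: fun_vs.subspace_add[OF subspace_coord_space])
    show "(x + y) j = (x + y) k" if "B \<in> \<pi>" "j \<in> B" "k \<in> B" for B j k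
      using block_spaceD[OF xy(1) that] block_spaceD[OF xy(2) that] by simp
  qed
next
  fix c and x :: "nat \<Rightarrow> 'a" assume x: "x \<in> block_space l \<pi>"
  show "scale_fun c x \<in> block_space l \<pi>"
  proof (rule block_spaceI)
    show "scale_fun c x \<in> coord_space l"
      using x block_space_subset by (blast intro: fun_vs.subspace_scale[OF subspace_coord_space])
    show "scale_fun c x j = scale_fun c x k" if "B \<in> \<pi>" "j \<in> B" "k \<in> B" for B j k
      using block_spaceD[OF x that] by (simp add: scale_fun_def)
  qed
qed

lemma block_indicator_in_block_space:
  assumes "partition_on {1..l} \<pi>" "B \<in> \<pi>"
  shows "(\<lambda>k. if k \<in> B then 1 else 0) \<in> (block_space l \<pi> :: (nat \<Rightarrow> 'a::field) set)"
proof -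
  have "B \<subseteq> {1..l}" using assms by (auto simp: partition_on_def)
  then have "(\<lambda>k. if k \<in> B then 1 else 0) \<in> (coord_space l :: (nat \<Rightarrow> 'a) set)"
    by (auto simp: coord_space_def)
  moreover have "j \<in> B \<longleftrightarrow> k \<in> B" if "C \<in> \<pi>" "j \<in> C" "k \<in> C" for C j k
    using assms that unfolding partition_on_def disjoint_def by blast
  ultimately show ?thesis by (intro block_spaceI) (assumption, metis)
qed

text \<open>
  Here \<open>b k\<close> is the block of \<open>k\<close> and \<open>\<rho> B\<close> is a representative of \<open>B\<close>.
\<close>

lemma partition_transversal:
  assumes "partition_on V \<pi>"
  obtains b \<rho> where "\<And>k. k \<in> V \<Longrightarrow> b k \<in> \<pi>" "\<And>k. k \<in> V \<Longrightarrow> k \<in> b k"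
    "\<And>B. B \<in> \<pi> \<Longrightarrow> \<rho> B \<in> B" "\<And>B k. B \<in> \<pi> \<Longrightarrow> k \<in> B \<Longrightarrow> b k = B"
proof -
  have "\<forall>k\<in>V. \<exists>B. B \<in> \<pi> \<and> k \<in> B" using assms by (auto simp: partition_on_def)
  then obtain b where b: "\<forall>k\<in>V. b k \<in> \<pi> \<and> k \<in> b k" by metis
  have "\<forall>B\<in>\<pi>. \<exists>k. k \<in> B" using partition_onD3[OF assms] by (metis equals0I)
  then obtain \<rho> where \<rho>: "\<forall>B\<in>\<pi>. \<rho> B \<in> B" by metis
  have "b k = B" if "B \<in> \<pi>" "k \<in> B" for B k
  proof -
    have "k \<in> V" using assms that by (auto simp: partition_on_def)
    then show ?thesis using b that assms by (auto simp: partition_on_def disjoint_def)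
  qed
  with b \<rho> show ?thesis by (intro that[of b \<rho>]) auto
qed

lemma dim_block_space:
  assumes "partition_on {1..l} \<pi>"
  shows "fun_vs.dim (block_space l \<pi> :: (nat \<Rightarrow> 'a::{field,finite}) set) = card \<pi>"
proof -
  obtain b \<rho> where b: "\<And>k. k \<in> {1..l} \<Longrightarrow> b k \<in> \<pi>" "\<And>k. k \<in> {1..l} \<Longrightarrow> k \<in> b k"
    "\<And>B. B \<in> \<pi> \<Longrightarrow> \<rho> B \<in> B" "\<And>B k. B \<in> \<pi> \<Longrightarrow> k \<in> B \<Longrightarrow> b k = B"
    using partition_transversal[OF assms] by blast
  have sub: "B \<subseteq> {1..l}" if "B \<in> \<pi>" for B using that assms by (auto simp: partition_on_def)
  have fin: "finite \<pi>" using assms finite_elements by blast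
  let ?W = "block_space l \<pi> :: (nat \<Rightarrow> 'a) set"
  have "bij_betw (\<lambda>x. restrict (\<lambda>B. x (\<rho> B)) \<pi>) ?W (\<pi> \<rightarrow>\<^sub>E UNIV)"
  proof (rule bij_betw_byWitness[where f' = "\<lambda>c k. if k \<in> {1..l} then c (b k) else 0"])
    show "\<forall>x\<in>?W. (\<lambda>k. if k \<in> {1..l} then restrict (\<lambda>B. x (\<rho> B)) \<pi> (b k) else 0) = x"
    proof (intro ballI ext)
      fix x k assume x: "x \<in> ?W"
      show "(if k \<in> {1..l} then restrict (\<lambda>B. x (\<rho> B)) \<pi> (b k) else 0) = x k"
      proof (cases "k \<in> {1..l}")
        case True
        then have "x (\<rho> (b k)) = x k" using block_spaceD[OF x b(1) b(3)[OF b(1)] b(2)] by blast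
        then show ?thesis using True b(1) by simp
      next
        case False
        then have "x k = 0" using x by (simp add: block_space_def coord_space_def)
        then show ?thesis using False by (simp del: atLeastAtMost_iff)
      qed
    qed
    show "\<forall>c \<in> \<pi> \<rightarrow>\<^sub>E (UNIV :: 'a set). restrict (\<lambda>B. if \<rho> B \<in> {1..l} then c (b (\<rho> B)) else 0) \<pi> = c"
    proof (intro ballI ext)
      fix c :: "nat set \<Rightarrow> 'a" and B assume c: "c \<in> \<pi> \<rightarrow>\<^sub>E UNIV"
      show "restrict (\<lambda>B. if \<rho> B \<in> {1..l} then c (b (\<rho> B)) else 0) \<pi> B = c B"
      proof (cases "B \<in> \<pi>")
        case True
        then have "\<rho> B \<in> {1..l}" "b (\<rho> B) = B" using b sub by blast+
        then show ?thesis using True by simp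
      next
        case False
        then show ?thesis using c by (simp add: PiE_def extensional_def)
      qed
    qed
    show "(\<lambda>c k. if k \<in> {1..l} then c (b k) else 0) ` (\<pi> \<rightarrow>\<^sub>E UNIV) \<subseteq> ?W"
    proof (intro image_subsetI block_spaceI)
      fix c :: "nat set \<Rightarrow> 'a" and B j k assume "B \<in> \<pi>" "j \<in> B" "k \<in> B"
      moreover from this have "j \<in> {1..l}" "k \<in> {1..l}" "b j = B" "b k = B" using b(4) sub by blast+
      ultimately show "(if j \<in> {1..l} then c (b j) else 0) = (if k \<in> {1..l} then c (b k) else 0)" by simp
    qed (auto simp: coord_space_def)
  qed auto
  then have "card ?W = CARD('a) ^ card \<pi>"
    using fin by (auto dest!: bij_betw_same_card simp: card_funcsetE)
  moreover have "finite ?W" using block_space_subset finite_coord_space finite_subset by blast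
  ultimately show ?thesis using fin_vs.dim_eq_iff_card[OF subspace_block_space] by blast
qed

text \<open>
  A torus element fixes the space iff it is constant on blocks.  So every orbit point is reached by exactly one
  torus element that is \<open>1\<close> at a chosen representative of each block, which leaves \<open>l - card \<pi>\<close> free
  coordinates.
\<close>

lemma card_orbit_block_space:
  assumes "partition_on {1..l} \<pi>"
  shows "card (orbit {1..l} (block_space l \<pi> :: (nat \<Rightarrow> 'a::{field,finite}) set)) = (CARD('a) - 1) ^ (l - card \<pi>)"
proof -
  obtain b \<rho> where b: "\<And>k. k \<in> {1..l} \<Longrightarrow> b k \<in> \<pi>" "\<And>k. k \<in> {1..l} \<Longrightarrow> k \<in> b k"
    "\<And>B. B \<in> \<pi> \<Longrightarrow> \<rho> B \<in> B" "\<And>B k. B \<in> \<pi> \<Longrightarrow> k \<in> B \<Longrightarrow> b k = B"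
    using partition_transversal[OF assms] by blast
  have sub: "B \<subseteq> {1..l}" if "B \<in> \<pi>" for B using that assms by (auto simp: partition_on_def)
  let ?W = "block_space l \<pi> :: (nat \<Rightarrow> 'a) set"
  define Q where "Q = {1..l} - \<rho> ` \<pi>"
  have "inj_on \<rho> \<pi>" using b by (metis inj_onI)
  then have "card Q = l - card \<pi>" unfolding Q_def
    using b(3) sub finite_elements[OF _ assms] by (subst card_Diff_subset) (auto simp: card_image)
  moreover have "inj_on (\<lambda>t. stretch t ?W) (torus Q)"
  proof (rule inj_on_stretch)
    fix t :: "nat \<Rightarrow> 'a" assume t: "t \<in> torus Q" "stretch t ?W = ?W"
    let ?e = "\<lambda>k. if k \<in> {1..l} then 1 else 0 :: 'a"
    have "?e \<in> ?W"
    proof (rule block_spaceI)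
      show "?e j = ?e k" if "B \<in> \<pi>" "j \<in> B" "k \<in> B" for B j k
        using that sub[OF that(1)] by auto
    qed (simp add: coord_space_def)
    then have e: "t * ?e \<in> ?W" using t(2) by (metis imageI stretch_def)
    have "t k = 1" if k: "k \<in> {1..l}" for k
    proof -
      have "\<rho> (b k) \<in> b k" "k \<in> b k" "b k \<in> \<pi>" "\<rho> (b k) \<in> {1..l}" using b k sub by blast+
      moreover from this have "(t * ?e) (\<rho> (b k)) = (t * ?e) k" by (blast intro: block_spaceD[OF e])
      ultimately have "t k = t (\<rho> (b k))" using k by simp
      also have "\<dots> = 1" using t(1) \<open>b k \<in> \<pi>\<close> by (simp add: torus_def Q_def)
      finally show ?thesis .
    qed
    moreover have "t k = 1" if "k \<notin> {1..l}" for k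
      using t(1) that unfolding torus_def Q_def by blast
    ultimately show "t = 1" by (metis ext one_fun_apply)
  qed
  moreover have "orbit {1..l} ?W = orbit Q ?W"
  proof (intro equalityI image_subsetI)
    fix t :: "nat \<Rightarrow> 'a" assume t: "t \<in> torus {1..l}"
    \<comment> \<open>Dividing \<open>t\<close> by its value at the representative of the block does not change the image of \<open>?W\<close>.\<close>
    define s where "s = (\<lambda>k. if k \<in> {1..l} then t (\<rho> (b k)) else 1)"
    have t0: "t k \<noteq> 0" for k using torus_nonzero[OF t] .
    then have s0: "s k \<noteq> 0" for k by (simp add: s_def)
    have s: "s j = s k" if "B \<in> \<pi>" "j \<in> B" "k \<in> B" for B j k
    proof -
      have "j \<in> {1..l}" "k \<in> {1..l}" "b j = B" "b k = B" using that b(4) sub by blast+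
      then show ?thesis by (simp add: s_def)
    qed
    have st: "(\<lambda>k. t k / s k) \<in> torus Q"
    proof -
      have "t k / s k = 1" if "k \<notin> Q" for k
      proof (cases "k \<in> {1..l}")
        case True
        then obtain B where B: "B \<in> \<pi>" "k = \<rho> B" using \<open>k \<notin> Q\<close> by (auto simp: Q_def)
        then have "b k = B" using b(3,4) by blast
        then show ?thesis using True B t0 by (simp add: s_def)
      next
        case False
        then have "t k = 1" using t unfolding torus_def by blast
        then show ?thesis using False by (simp add: s_def del: atLeastAtMost_iff)
      qed
      then show ?thesis using t0 s0 by (simp add: torus_def)
    qed
    have "stretch t ?W = stretch (\<lambda>k. t k / s k) ?W"
    proof -
      have "stretch s ?W = ?W"
      proof
        have step: "u * x \<in> ?W" if "x \<in> ?W" "\<And>B j k. B \<in> \<pi> \<Longrightarrow> j \<in> B \<Longrightarrow> k \<in> B \<Longrightarrow> u j = u k" for u x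
        proof (rule block_spaceI)
          show "u * x \<in> coord_space l" using that(1) block_space_subset by (auto simp: coord_space_def)
          show "(u * x) j = (u * x) k" if "B \<in> \<pi>" "j \<in> B" "k \<in> B" for B j k
            using that(1,2,3) \<open>\<And>B j k. B \<in> \<pi> \<Longrightarrow> j \<in> B \<Longrightarrow> k \<in> B \<Longrightarrow> u j = u k\<close>[OF that]
              block_spaceD[OF \<open>x \<in> ?W\<close> that] by simp
        qed
        show "stretch s ?W \<subseteq> ?W" unfolding stretch_def
          by (rule image_subsetI, rule step, assumption, rule s)
        show "?W \<subseteq> stretch s ?W"
        proof
          fix x assume "x \<in> ?W"
          then have "(\<lambda>k. inverse (s k)) * x \<in> ?W"
            by (rule step) (rule arg_cong[where f = inverse], rule s)
          moreover have "x = s * ((\<lambda>k. inverse (s k)) * x)" using s0 by (simp add: fun_eq_iff)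
          ultimately show "x \<in> stretch s ?W" by (rule stretchI)
        qed
      qed
      then have "stretch (\<lambda>k. t k / s k) ?W = stretch ((\<lambda>k. t k / s k) * s) ?W"
        by (metis stretch_stretch)
      also have "(\<lambda>k. t k / s k) * s = t" using s0 by (simp add: fun_eq_iff)
      finally show ?thesis by simp
    qed
    then show "stretch t ?W \<in> orbit Q ?W" using st by simp
  next
    fix t :: "nat \<Rightarrow> 'a" assume "t \<in> torus Q"
    then have "t \<in> torus {1..l}" using torus_mono[of Q "{1..l}"] by (auto simp: Q_def)
    then show "stretch t ?W \<in> orbit {1..l} ?W" by simp
  qed
  moreover have "finite Q" by (simp add: Q_def)
  ultimately show ?thesis by (simp add: card_image card_torus)
qed

text \<open>
  The torus does not change the zero patterns of the vectors of a subspace, and those of a block space determine the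
  blocks.  Hence different partitions give disjoint orbits.
\<close>

lemma same_block_iff_same_zeros:
  assumes "partition_on {1..l} \<pi>" "t \<in> torus Q" "j \<in> {1..l}" "k \<in> {1..l}"
  shows "(\<exists>B\<in>\<pi>. j \<in> B \<and> k \<in> B) \<longleftrightarrow> (\<forall>x \<in> stretch t (block_space l \<pi>). x j = 0 \<longleftrightarrow> x k = 0)"
proof
  assume "\<exists>B\<in>\<pi>. j \<in> B \<and> k \<in> B"
  then obtain B where B: "B \<in> \<pi>" "j \<in> B" "k \<in> B" by blast
  have "(t * y) j = 0 \<longleftrightarrow> (t * y) k = 0" if "y \<in> block_space l \<pi>" for y
    using block_spaceD[OF that B] torus_nonzero[OF assms(2)] by simp
  then show "\<forall>x \<in> stretch t (block_space l \<pi>). x j = 0 \<longleftrightarrow> x k = 0"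
    unfolding stretch_def by blast
next
  assume R: "\<forall>x \<in> stretch t (block_space l \<pi>). x j = 0 \<longleftrightarrow> x k = 0"
  obtain B where B: "B \<in> \<pi>" "j \<in> B" using assms(3) unfolding partition_onD1[OF assms(1)] by blast
  let ?x = "\<lambda>k. if k \<in> B then 1 else 0"
  have "t * ?x \<in> stretch t (block_space l \<pi>)"
    using block_indicator_in_block_space[OF assms(1) B(1)] by (auto simp: stretch_def)
  then have "(t * ?x) j = 0 \<longleftrightarrow> (t * ?x) k = 0" using R by blast
  then have "k \<in> B" using B(2) torus_nonzero[OF assms(2)] by (simp split: if_splits)
  then show "\<exists>B\<in>\<pi>. j \<in> B \<and> k \<in> B" using B by blast
qed

lemma partition_on_subset_if_same_blocks:
  assumes "partition_on V \<pi>" "partition_on V \<pi>'"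
    and same: "\<And>j k. j \<in> V \<Longrightarrow> k \<in> V \<Longrightarrow> (\<exists>B\<in>\<pi>. j \<in> B \<and> k \<in> B) \<longleftrightarrow> (\<exists>B\<in>\<pi>'. j \<in> B \<and> k \<in> B)"
  shows "\<pi> \<subseteq> \<pi>'"
proof
  fix B assume B: "B \<in> \<pi>"
  then obtain j where j: "j \<in> B" using partition_onD3[OF assms(1)] by (metis equals0I)
  have BV: "B \<subseteq> V" using B assms(1) by (auto simp: partition_on_def)
  then obtain C where C: "C \<in> \<pi>'" "j \<in> C" using j assms(2) by (auto simp: partition_on_def)
  have CV: "C \<subseteq> V" using C assms(2) by (auto simp: partition_on_def)
  have "k \<in> B \<longleftrightarrow> k \<in> C" if "k \<in> V" for k
  proof -
    have "k \<in> B \<longleftrightarrow> (\<exists>B\<in>\<pi>. j \<in> B \<and> k \<in> B)"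
      using B j assms(1) unfolding partition_on_def disjoint_def by blast
    also have "\<dots> \<longleftrightarrow> (\<exists>B\<in>\<pi>'. j \<in> B \<and> k \<in> B)" using same that j BV by blast
    also have "\<dots> \<longleftrightarrow> k \<in> C"
      using C assms(2) unfolding partition_on_def disjoint_def by blast
    finally show ?thesis .
  qed
  then have "B = C" using BV CV by blast
  then show "B \<in> \<pi>'" using C by simp
qed

lemma orbits_of_block_spaces_disjoint:
  assumes "partition_on {1..l} \<pi>" "partition_on {1..l} \<pi>'" "\<pi> \<noteq> \<pi>'"
  shows "orbit {1..l} (block_space l \<pi> :: (nat \<Rightarrow> 'a::field) set) \<inter> orbit {1..l} (block_space l \<pi>') = {}"
proof (rule ccontr)
  assume "orbit {1..l} (block_space l \<pi> :: (nat \<Rightarrow> 'a) set) \<inter> orbit {1..l} (block_space l \<pi>') \<noteq> {}"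
  then obtain s t :: "nat \<Rightarrow> 'a" where st: "s \<in> torus {1..l}" "t \<in> torus {1..l}"
    "stretch s (block_space l \<pi>) = stretch t (block_space l \<pi>')"
    by (auto simp: disjoint_iff)
  have same: "(\<exists>B\<in>\<pi>. j \<in> B \<and> k \<in> B) \<longleftrightarrow> (\<exists>B\<in>\<pi>'. j \<in> B \<and> k \<in> B)"
    if "j \<in> {1..l}" "k \<in> {1..l}" for j k
    unfolding same_block_iff_same_zeros[OF assms(1) st(1) that] same_block_iff_same_zeros[OF assms(2) st(2) that]
      st(3) ..
  have "\<pi> = \<pi>'"
    using partition_on_subset_if_same_blocks[OF assms(1,2) same]
      partition_on_subset_if_same_blocks[OF assms(2,1) same[symmetric]]
    by (rule equalityI)
  then show False using assms(3) by simp
qed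

text \<open>
  Let \<open>w p\<close> be the basis of \<open>W\<close> dual to coordinates \<open>P\<close>.  If \<open>t\<close> fixes \<open>W\<close>, then \<open>t * w p\<close> and
  \<open>t p\<close> times \<open>w p\<close> are vectors of \<open>W\<close> that agree on \<open>P\<close>, hence everywhere; so \<open>t\<close> is constant on the
  support of \<open>w p\<close>.  As \<open>W\<close> is not a stretched block space, two supports overlap, say those of
  \<open>p\<close> and \<open>p'\<close>.  If moreover \<open>t\<close> is \<open>1\<close> on \<open>P - {p'}\<close>, then \<open>t p' = t p = 1\<close> by the overlap,
  and as the supports cover all coordinates, \<open>t = 1\<close>.
\<close>

lemma stretched_block_space_or_free_subtorus:
  fixes W :: "(nat \<Rightarrow> 'a::{field,finite}) set"
  assumes W: "fun_vs.subspace W" "W \<subseteq> coord_space l"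
    and loopless: "\<And>k. k \<in> {1..l} \<Longrightarrow> \<exists>x\<in>W. x k \<noteq> 0"
    and not_block: "\<And>\<pi>. partition_on {1..l} \<pi> \<Longrightarrow> W \<notin> orbit {1..l} (block_space l \<pi>)"
  shows "\<exists>Q\<subseteq>{1..l}. card Q = Suc (l - fun_vs.dim W) \<and> (\<forall>t \<in> torus Q. stretch t W = W \<longrightarrow> t = 1)"
proof -
  obtain P w where sub: "P \<subseteq> {1..l}" and cardP: "card P = fun_vs.dim W"
    and wW: "\<And>p. p \<in> P \<Longrightarrow> w p \<in> W"
    and w: "\<And>p p'. p \<in> P \<Longrightarrow> p' \<in> P \<Longrightarrow> w p p' = (if p = p' then 1 else 0)"
    and expand: "\<And>x k. x \<in> W \<Longrightarrow> x k = (\<Sum>p\<in>P. x p * w p k)"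
    using coordinate_basis[OF W] by blast
  have finP: "finite P" using sub finite_subset by blast
  have cover: "\<exists>p\<in>P. w p k \<noteq> 0" if "k \<in> {1..l}" for k
  proof (rule ccontr)
    assume "\<not> (\<exists>p\<in>P. w p k \<noteq> 0)"
    then have "x k = 0" if "x \<in> W" for x using expand[OF that, of k] by simp
    then show False using loopless[OF \<open>k \<in> {1..l}\<close>] by blast
  qed
  have eigen: "t k = t p" if "p \<in> P" "w p k \<noteq> 0" "stretch t W = W" for t p k
  proof -
    have "t * w p \<in> W" using wW that by (metis imageI stretch_def)
    then have "(t * w p) k = (\<Sum>p'\<in>P. (t * w p) p' * w p' k)" by (rule expand)
    also have "\<dots> = (\<Sum>p'\<in>P. if p = p' then t p * w p k else 0)"
      using w that(1) by (intro sum.cong) auto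
    also have "\<dots> = t p * w p k" using finP that(1) by simp
    finally show ?thesis using that(2) by simp
  qed
  \<comment> \<open>Otherwise the supports would be the blocks of a partition, and \<open>W\<close> a stretched block space.\<close>
  have "\<exists>k\<in>{1..l}. \<exists>p\<in>P. \<exists>p'\<in>P. p \<noteq> p' \<and> w p k \<noteq> 0 \<and> w p' k \<noteq> 0"
  proof (rule ccontr)
    assume "\<not> ?thesis"
    then have uniq: "\<And>k p p'. k \<in> {1..l} \<Longrightarrow> p \<in> P \<Longrightarrow> p' \<in> P \<Longrightarrow> w p k \<noteq> 0 \<Longrightarrow> w p' k \<noteq> 0 \<Longrightarrow> p = p'"
      by blast
    obtain \<phi> where \<phi>: "\<And>k. k \<in> {1..l} \<Longrightarrow> \<phi> k \<in> P" "\<And>k. k \<in> {1..l} \<Longrightarrow> w (\<phi> k) k \<noteq> 0"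
      using cover by metis
    have \<phi>_id: "\<phi> p = p" if "p \<in> P" for p
      using uniq[of p "\<phi> p" p] \<phi>[of p] w[OF that that] that sub by auto
    have only: "(\<Sum>p\<in>P. c p * w p k) = c (\<phi> k) * w (\<phi> k) k" if k: "k \<in> {1..l}" for c k
    proof -
      have "(\<Sum>p\<in>P. c p * w p k) = (\<Sum>p\<in>P. if p = \<phi> k then c (\<phi> k) * w (\<phi> k) k else 0)"
        using uniq[OF k _ \<phi>(1)[OF k] _ \<phi>(2)[OF k]] by (intro sum.cong) auto
      then show ?thesis using finP \<phi>(1)[OF k] by simp
    qed
    define \<pi> where "\<pi> = (\<lambda>p. {k \<in> {1..l}. \<phi> k = p}) ` P"
    define t where "t = (\<lambda>k. if k \<in> {1..l} then w (\<phi> k) k else 1)"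
    have "partition_on {1..l} \<pi>"
    proof (rule partition_onI)
      show "\<Union>\<pi> = {1..l}" using \<phi>(1) by (auto simp: \<pi>_def)
      show "disjnt B C" if "B \<in> \<pi>" "C \<in> \<pi>" "B \<noteq> C" for B C
        using that by (auto simp: \<pi>_def disjnt_def)
      have "B \<noteq> {}" if "B \<in> \<pi>" for B
      proof -
        from that obtain p where "p \<in> P" "B = {k \<in> {1..l}. \<phi> k = p}" unfolding \<pi>_def by blast
        then have "p \<in> B" using \<phi>_id sub by auto
        then show ?thesis by blast
      qed
      then show "{} \<notin> \<pi>" by blast
    qed
    moreover have "t \<in> torus {1..l}" using \<phi>(2) by (auto simp: t_def torus_def)
    moreover have "W = stretch t (block_space l \<pi>)"
    proof (intro equalityI subsetI)
      fix x assume x: "x \<in> W"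
      let ?y = "\<lambda>k. if k \<in> {1..l} then x (\<phi> k) else 0"
      have "?y \<in> block_space l \<pi>" by (rule block_spaceI) (auto simp: coord_space_def \<pi>_def)
      moreover have "x k = (t * ?y) k" for k
      proof (cases "k \<in> {1..l}")
        case True
        then show ?thesis using expand[OF x, of k] only[OF True, of x] by (simp add: t_def mult.commute)
      next
        case False
        then show ?thesis using x W(2) by (auto simp: coord_space_def)
      qed
      then have "x = t * ?y" by (rule ext)
      ultimately show "x \<in> stretch t (block_space l \<pi>)" by (rule stretchI)
    next
      fix x assume "x \<in> stretch t (block_space l \<pi>)"
      then obtain y where y: "y \<in> block_space l \<pi>" "x = t * y" by (auto simp: stretch_def)
      have "x k = (\<Sum>p\<in>P. scale_fun (y p) (w p)) k" for k
      proof (cases "k \<in> {1..l}")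
        case True
        have "\<phi> k \<in> {1..l}" "\<phi> (\<phi> k) = \<phi> k" using \<phi>(1)[OF True] \<phi>_id sub by auto
        then have "k \<in> {j \<in> {1..l}. \<phi> j = \<phi> k}" "\<phi> k \<in> {j \<in> {1..l}. \<phi> j = \<phi> k}" using True by auto
        moreover have "{j \<in> {1..l}. \<phi> j = \<phi> k} \<in> \<pi>" using \<phi>(1)[OF True] by (auto simp: \<pi>_def)
        ultimately have "y k = y (\<phi> k)" by (intro block_spaceD[OF y(1)])
        then show ?thesis using True only[OF True, of y]
          by (simp add: y(2) t_def sum_fun_apply scale_fun_def mult.commute)
      next
        case False
        have "y \<in> coord_space l" "\<And>p. p \<in> P \<Longrightarrow> w p \<in> coord_space l"
          using y(1) block_space_subset wW W(2) by blast+
        with False have "y k = 0" "\<And>p. p \<in> P \<Longrightarrow> w p k = 0"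
          unfolding coord_space_def by blast+
        then show ?thesis by (simp add: y(2) sum_fun_apply scale_fun_def)
      qed
      then have "x = (\<Sum>p\<in>P. scale_fun (y p) (w p))" by (rule ext)
      also have "\<dots> \<in> W" using wW W(1) by (intro fun_vs.subspace_sum fun_vs.subspace_scale) auto
      finally show "x \<in> W" .
    qed
    ultimately show False using not_block by blast
  qed
  then obtain k p p' where k: "k \<in> {1..l}" "p \<in> P" "p' \<in> P" "p \<noteq> p'" "w p k \<noteq> 0" "w p' k \<noteq> 0"
    by blast
  let ?Q = "insert p' ({1..l} - P)"
  have "card ?Q = Suc (l - card P)"
    using k(3) sub finP by (simp add: card_Diff_subset)
  moreover have "t = 1" if t: "t \<in> torus ?Q" "stretch t W = W" for t
  proof -
    have one: "t j = 1" if "j \<notin> ?Q" for j using t(1) that unfolding torus_def by blast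
    have p: "t p = 1" using one k by blast
    have p': "t p' = 1" using eigen[OF k(2,5) t(2)] eigen[OF k(3,6) t(2)] p by simp
    have P1: "t j = 1" if "j \<in> P" for j using p' one[of j] that by blast
    have "t j = 1" for j
    proof (cases "j \<in> {1..l}")
      case True
      then obtain r where "r \<in> P" "w r j \<noteq> 0" using cover by blast
      then show ?thesis using eigen[OF _ _ t(2)] P1 by metis
    next
      case False
      then have "j \<notin> ?Q" using k(3) sub by auto
      then show ?thesis by (rule one)
    qed
    then show "t = 1" by (simp add: fun_eq_iff)
  qed
  moreover have "?Q \<subseteq> {1..l}" using k(3) sub by auto
  ultimately show ?thesis using cardP by metis
qed

section \<open>Subspaces contained in no hyperplane of the arrangement\<close>

definition avoiding_subspaces :: "nat \<Rightarrow> nat set set \<Rightarrow> nat \<Rightarrow> (nat \<Rightarrow> 'a::{field,finite}) set set" where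
  "avoiding_subspaces l E i = {W. fun_vs.subspace W \<and> W \<subseteq> coord_space l \<and>
     (\<forall>H \<in> q_graphical_arrangement l E. \<not> W \<subseteq> H) \<and> fun_vs.dim W = i}"

lemma finite_avoiding_subspaces: "finite (avoiding_subspaces l E i)"
proof (rule finite_subset)
  show "avoiding_subspaces l E i \<subseteq> Pow (coord_space l)" by (auto simp: avoiding_subspaces_def)
qed (simp add: finite_coord_space)

lemma avoids_arrangement_iff:
  fixes W :: "(nat \<Rightarrow> 'a::{field,finite}) set"
  assumes "W \<subseteq> coord_space l"
  shows "(\<forall>H \<in> q_graphical_arrangement l E. \<not> W \<subseteq> H) \<longleftrightarrow>
    (\<forall>S a. clique {1..l} E S \<longrightarrow> S \<noteq> {} \<longrightarrow> (\<exists>i\<in>S. a i \<noteq> 0) \<longrightarrow> (\<exists>x\<in>W. (\<Sum>i\<in>S. a i * x i) \<noteq> 0))"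
proof -
  have "W \<subseteq> {x \<in> coord_space l. (\<Sum>i\<in>S. a i * x i) = 0} \<longleftrightarrow> (\<forall>x\<in>W. (\<Sum>i\<in>S. a i * x i) = 0)" for S a
    using assms by blast
  then show ?thesis unfolding q_graphical_arrangement_def by blast
qed

text \<open>
  The torus permutes the hyperplanes of the arrangement, since scaling the coefficients of a linear
  form does not change its support.
\<close>

lemma stretch_avoids_arrangement:
  fixes W :: "(nat \<Rightarrow> 'a::{field,finite}) set"
  assumes W: "W \<subseteq> coord_space l" "\<forall>H \<in> q_graphical_arrangement l E. \<not> W \<subseteq> H" and t: "t \<in> torus Q"
  shows "\<forall>H \<in> q_graphical_arrangement l E. \<not> stretch t W \<subseteq> H"
  unfolding avoids_arrangement_iff[OF stretch_subset_coord_space[OF W(1)]]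
proof (intro allI impI)
  fix S a assume S: "clique {1..l} E S" "S \<noteq> {}" "\<exists>i\<in>S. a i \<noteq> (0::'a)"
  have "\<exists>i\<in>S. a i * t i \<noteq> 0" using S(3) torus_nonzero[OF t] by simp
  then obtain x where "x \<in> W" "(\<Sum>i\<in>S. a i * t i * x i) \<noteq> 0"
    using W(2)[unfolded avoids_arrangement_iff[OF W(1)], rule_format, OF S(1,2), of "\<lambda>i. a i * t i"] by blast
  then show "\<exists>x\<in>stretch t W. (\<Sum>i\<in>S. a i * x i) \<noteq> 0"
    by (intro bexI[of _ "t * x"] stretchI[of x]) (simp_all add: mult.assoc)
qed

lemma stretch_in_avoiding_subspaces:
  assumes "W \<in> avoiding_subspaces l E i" "t \<in> torus Q"
  shows "stretch t W \<in> avoiding_subspaces l E i"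
proof -
  have W: "fun_vs.subspace W" "W \<subseteq> coord_space l" "\<forall>H \<in> q_graphical_arrangement l E. \<not> W \<subseteq> H"
    "fun_vs.dim W = i" using assms(1) by (auto simp: avoiding_subspaces_def)
  have "finite W" using W(2) finite_coord_space finite_subset by blast
  then show ?thesis
    using W subspace_stretch[OF W(1)] stretch_subset_coord_space[OF W(2)]
      stretch_avoids_arrangement[OF W(2,3) assms(2)] dim_stretch[OF W(1) _ assms(2)]
    by (simp add: avoiding_subspaces_def)
qed

text \<open>
  If an edge \<open>{u, v}\<close> joins two vertices of one block, the hyperplane \<open>x\<^sub>u = x\<^sub>v\<close> contains the block space.
  If the partition is stable, a block meets a clique in at most one vertex, so the indicator vector
  of the block of \<open>i\<close> is outside every hyperplane with \<open>a\<^sub>i \<noteq> 0\<close>.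
\<close>

lemma block_space_avoids_arrangement_iff:
  assumes graph: "simple_graph {1..l} E" and \<pi>: "partition_on {1..l} \<pi>"
  shows "(\<forall>H \<in> q_graphical_arrangement l E. \<not> (block_space l \<pi> :: (nat \<Rightarrow> 'a::{field,finite}) set) \<subseteq> H)
    \<longleftrightarrow> stable_partition {1..l} E \<pi>"
  unfolding avoids_arrangement_iff[OF block_space_subset]
proof
  assume avoid: "\<forall>S a. clique {1..l} E S \<longrightarrow> S \<noteq> {} \<longrightarrow> (\<exists>i\<in>S. a i \<noteq> 0) \<longrightarrow>
      (\<exists>x\<in>(block_space l \<pi> :: (nat \<Rightarrow> 'a) set). (\<Sum>i\<in>S. a i * x i) \<noteq> 0)"
  have "{u, v} \<notin> E" if "B \<in> \<pi>" "u \<in> B" "v \<in> B" for B u v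
  proof
    assume uv: "{u, v} \<in> E"
    then have "u \<noteq> v" and sub: "{u, v} \<subseteq> {1..l}"
      using graph by (auto simp: simple_graph_def)
    have cl: "clique {1..l} E {u, v}" using uv sub by (auto simp: clique_def insert_commute)
    let ?a = "\<lambda>i. if i = u then 1 else - 1 :: 'a"
    obtain x :: "nat \<Rightarrow> 'a" where x: "x \<in> block_space l \<pi>" "(\<Sum>i\<in>{u, v}. ?a i * x i) \<noteq> 0"
      using avoid[rule_format, OF cl, of ?a] by auto
    have "x u = x v" using block_spaceD[OF x(1) that] .
    then show False using x(2) \<open>u \<noteq> v\<close> by simp
  qed
  then show "stable_partition {1..l} E \<pi>" using \<pi> by (simp add: stable_partition_def)
next
  assume stable: "stable_partition {1..l} E \<pi>"
  show "\<forall>S a. clique {1..l} E S \<longrightarrow> S \<noteq> {} \<longrightarrow> (\<exists>i\<in>S. a i \<noteq> 0) \<longrightarrow>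
      (\<exists>x\<in>(block_space l \<pi> :: (nat \<Rightarrow> 'a) set). (\<Sum>i\<in>S. a i * x i) \<noteq> 0)"
  proof (intro allI impI)
    fix S and a :: "nat \<Rightarrow> 'a" assume S: "clique {1..l} E S" "\<exists>i\<in>S. a i \<noteq> 0"
    then obtain i where i: "i \<in> S" "a i \<noteq> 0" by blast
    have SV: "S \<subseteq> {1..l}" using S(1) by (simp add: clique_def)
    then obtain B where B: "B \<in> \<pi>" "i \<in> B" using i(1) unfolding partition_onD1[OF \<pi>] by blast
    have only: "j = i" if "j \<in> S" "j \<in> B" for j
    proof (rule ccontr)
      assume "j \<noteq> i"
      then have "{j, i} \<in> E" using S(1) that(1) i(1) by (simp add: clique_def)
      then show False using stable B that(2) unfolding stable_partition_def by blast
    qed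
    let ?x = "\<lambda>k. if k \<in> B then 1 else 0 :: 'a"
    have "(\<Sum>k\<in>S. a k * ?x k) = (\<Sum>k\<in>S. if k = i then a i else 0)"
    proof (rule sum.cong)
      fix k assume "k \<in> S"
      then have "k \<in> B \<longleftrightarrow> k = i" using only B(2) by blast
      then show "a k * ?x k = (if k = i then a i else 0)" by simp
    qed simp
    also have "\<dots> = a i" using i(1) finite_subset[OF SV] by simp
    finally have "(\<Sum>k\<in>S. a k * ?x k) \<noteq> 0" using i(2) by simp
    then show "\<exists>x\<in>block_space l \<pi>. (\<Sum>i\<in>S. a i * x i) \<noteq> 0"
      using block_indicator_in_block_space[OF \<pi> B(1)] by (rule bexI)
  qed
qed

text \<open>
  The orbits of the block spaces of stable partitions account for the first summand.  On the orbit of each remaining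
  subspace a subtorus of rank \<open>l - i + 1\<close> acts freely, which gives the second summand its additional factor \<open>q - 1\<close>.
\<close>

lemma card_avoiding_subspaces:
  assumes graph: "simple_graph {1..l} E"
  obtains z where "card (avoiding_subspaces l E i :: (nat \<Rightarrow> 'a::{field,finite}) set set) =
    (CARD('a) - 1) ^ (l - i) * (card {\<pi>. stable_partition {1..l} E \<pi> \<and> card \<pi> = i} + (CARD('a) - 1) * z)"
proof -
  let ?X = "avoiding_subspaces l E i :: (nat \<Rightarrow> 'a) set set"
  let ?q = "CARD('a) - 1"
  let ?I = "{1..l}"
  let ?\<Pi> = "{\<pi>. stable_partition ?I E \<pi> \<and> card \<pi> = i}"
  let ?orb = "\<lambda>\<pi>. orbit ?I (block_space l \<pi> :: (nat \<Rightarrow> 'a) set)"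
  define good where "good = (\<Union>\<pi>\<in>?\<Pi>. ?orb \<pi>)"
  have part: "partition_on ?I \<pi>" if "\<pi> \<in> ?\<Pi>" for \<pi> using that by (simp add: stable_partition_def)
  have fin\<Pi>: "finite ?\<Pi>"
    using part finitely_many_partition_on[of ?I] by (auto intro: finite_subset[of _ "{\<pi>. partition_on ?I \<pi>}"])
  have mem: "block_space l \<pi> \<in> ?X \<longleftrightarrow> \<pi> \<in> ?\<Pi>" if "partition_on ?I \<pi>" for \<pi>
    using block_space_avoids_arrangement_iff[OF graph that, where 'a = 'a] dim_block_space[OF that, where 'a = 'a]
    by (simp add: avoiding_subspaces_def subspace_block_space block_space_subset)
  have good_sub: "good \<subseteq> ?X"
  proof
    fix U assume "U \<in> good"
    then obtain \<pi> t where "\<pi> \<in> ?\<Pi>" "t \<in> torus ?I" "U = stretch t (block_space l \<pi>)"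
      unfolding good_def by blast
    then show "U \<in> ?X" using mem part stretch_in_avoiding_subspaces by metis
  qed
  have bad: "W \<notin> ?orb \<pi>" if W: "W \<in> ?X - good" and \<pi>: "partition_on ?I \<pi>" for W \<pi>
  proof
    assume "W \<in> ?orb \<pi>"
    then obtain t where t: "t \<in> torus ?I" "W = stretch t (block_space l \<pi>)" by blast
    then have "stretch (\<lambda>k. inverse (t k)) W = block_space l \<pi>" by (simp add: stretch_inverse)
    then have "block_space l \<pi> \<in> ?X"
      using stretch_in_avoiding_subspaces[OF _ inverse_in_torus[OF t(1)]] W by (metis DiffD1)
    then have "W \<in> good" using mem[OF \<pi>] \<open>W \<in> ?orb \<pi>\<close> unfolding good_def by blast
    then show False using W by blast
  qed
  have "?q ^ Suc (l - i) dvd card (?X - good)"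
  proof (rule dvd_card_of_free_subtori[of _ ?I])
    show "finite (?X - good)" by (rule finite_Diff[OF finite_avoiding_subspaces])
    show "stretch t W \<in> ?X - good" if t: "t \<in> torus ?I" and W: "W \<in> ?X - good" for t W
    proof (rule DiffI)
      show "stretch t W \<in> ?X" using stretch_in_avoiding_subspaces t W by blast
      show "stretch t W \<notin> good"
      proof
        assume "stretch t W \<in> good"
        then obtain \<pi> u where u: "\<pi> \<in> ?\<Pi>" "u \<in> torus ?I" "stretch t W = stretch u (block_space l \<pi>)"
          unfolding good_def by blast
        let ?t = "\<lambda>k. inverse (t k)"
        have "W = stretch ?t (stretch t W)" using t by (simp add: stretch_inverse)
        also have "\<dots> = stretch (?t * u) (block_space l \<pi>)" by (simp add: u(3) stretch_stretch)
        finally have "W \<in> ?orb \<pi>"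
          using mult_in_torus[OF inverse_in_torus[OF t] u(2)] by blast
        then show False using bad[OF W part[OF u(1)]] by blast
      qed
    qed
    fix W assume W: "W \<in> ?X - good"
    then have W': "fun_vs.subspace W" "W \<subseteq> coord_space l" "fun_vs.dim W = i"
      and avoid: "\<forall>H \<in> q_graphical_arrangement l E. \<not> W \<subseteq> H"
      by (auto simp: avoiding_subspaces_def)
    \<comment> \<open>The coordinate hyperplanes belong to the arrangement, because single vertices are cliques.\<close>
    have "\<exists>x\<in>W. x k \<noteq> 0" if "k \<in> ?I" for k
    proof -
      have "clique ?I E {k}" using that by (simp add: clique_def)
      then show ?thesis
        using avoid[unfolded avoids_arrangement_iff[OF W'(2)], rule_format, of "{k}" "\<lambda>_. 1"] by simp
    qed
    then show "\<exists>Q\<subseteq>?I. card Q = Suc (l - i) \<and> (\<forall>t \<in> torus Q. stretch t W = W \<longrightarrow> t = 1)"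
      using stretched_block_space_or_free_subtorus[OF W'(1,2)] bad[OF W] W'(3) by blast
  qed simp
  then obtain z where z: "card (?X - good) = ?q ^ Suc (l - i) * z" by (rule dvdE)
  have finorb: "finite (?orb \<pi>)" if "\<pi> \<in> ?\<Pi>" for \<pi>
    using good_sub that finite_avoiding_subspaces[of l E i, where 'a = 'a] finite_subset[of "?orb \<pi>" ?X]
    unfolding good_def by blast
  have "card good = (\<Sum>\<pi>\<in>?\<Pi>. card (?orb \<pi>))" unfolding good_def
  proof (rule card_UN_disjoint[OF fin\<Pi>])
    show "\<forall>\<pi>\<in>?\<Pi>. finite (?orb \<pi>)" using finorb by blast
    show "\<forall>\<pi>\<in>?\<Pi>. \<forall>\<pi>'\<in>?\<Pi>. \<pi> \<noteq> \<pi>' \<longrightarrow> ?orb \<pi> \<inter> ?orb \<pi>' = {}"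
      using orbits_of_block_spaces_disjoint[OF part part] by blast
  qed
  also have "\<dots> = (\<Sum>\<pi>\<in>?\<Pi>. ?q ^ (l - i))"
    using card_orbit_block_space[OF part, where 'a = 'a] by (intro sum.cong) auto
  finally have "card good = card ?\<Pi> * ?q ^ (l - i)" by simp
  moreover have "card ?X = card good + card (?X - good)"
    using card_Diff_subset[OF finite_subset[OF good_sub finite_avoiding_subspaces] good_sub]
      card_mono[OF finite_avoiding_subspaces good_sub] by simp
  ultimately have "card ?X = ?q ^ (l - i) * (card ?\<Pi> + ?q * z)"
    by (simp add: z algebra_simps)
  then show ?thesis by (rule that)
qed

lemma dim_le_of_subset_coord_space:
  fixes W :: "(nat \<Rightarrow> 'a::{field,finite}) set"
  assumes "fun_vs.subspace W" "W \<subseteq> coord_space l"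
  shows "fun_vs.dim W \<le> l"
proof -
  have "CARD('a) ^ fun_vs.dim W \<le> CARD('a) ^ l"
    using fin_vs.card_subspace[OF assms(1) finite_subset[OF assms(2) finite_coord_space]]
      card_mono[OF finite_coord_space assms(2)] by (simp add: card_coord_space)
  then show ?thesis
    using field_card_ge_2[where 'a = 'a] by (subst (asm) power_increasing_iff) auto
qed

lemma arrangement_hyperplanes:
  fixes H :: "(nat \<Rightarrow> 'a::{field,finite}) set"
  assumes "H \<in> q_graphical_arrangement l E"
  shows "fun_vs.subspace H" "\<not> coord_space l \<subseteq> H"
proof -
  obtain S a where H: "H = {x \<in> coord_space l. (\<Sum>i\<in>S. a i * x i) = 0}"
    "clique {1..l} E S" "\<exists>i\<in>S. a i \<noteq> 0"
    using assms unfolding q_graphical_arrangement_def by blast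
  have SV: "S \<subseteq> {1..l}" using H(2) by (simp add: clique_def)
  show "fun_vs.subspace H"
  proof (rule fun_vs.subspaceI)
    fix c x y assume "x \<in> H"
    moreover have "(\<Sum>i\<in>S. a i * scale_fun c x i) = c * (\<Sum>i\<in>S. a i * x i)"
      by (simp add: scale_fun_def sum_distrib_left mult_ac)
    ultimately show "scale_fun c x \<in> H"
      unfolding H(1) by (simp add: fun_vs.subspace_scale[OF subspace_coord_space])
    assume "y \<in> H"
    then show "x + y \<in> H" using \<open>x \<in> H\<close>
      unfolding H(1) by (simp add: fun_vs.subspace_add[OF subspace_coord_space] distrib_left sum.distrib)
  qed (simp add: H(1) fun_vs.subspace_0[OF subspace_coord_space])
  obtain i where i: "i \<in> S" "a i \<noteq> 0" using H(3) by blast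
  let ?x = "\<lambda>k. if k = i then 1 else 0 :: 'a"
  have "?x \<in> coord_space l" using i(1) SV by (auto simp: coord_space_def)
  moreover have "(\<Sum>k\<in>S. a k * ?x k) = a i"
    using i(1) finite_subset[OF SV] by (simp add: if_distrib cong: if_cong)
  ultimately show "\<not> coord_space l \<subseteq> H" using i(2) unfolding H(1) by auto
qed

lemma char_poly_arrangement:
  "fun_vs.char_poly (coord_space l) (q_graphical_arrangement l E :: (nat \<Rightarrow> 'a::{field,finite}) set set) =
   (\<Sum>i\<le>l. smult (int (card (avoiding_subspaces l E i :: (nat \<Rightarrow> 'a) set set))) (q_falling CARD('a) i))"
proof -
  let ?A = "q_graphical_arrangement l E :: (nat \<Rightarrow> 'a) set set"
  let ?V = "coord_space l :: (nat \<Rightarrow> 'a) set"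
  let ?X = "{W. (fun_vs.subspace W \<and> W \<subseteq> ?V) \<and> (\<forall>H\<in>?A. \<not> W \<subseteq> H)}"
  let ?f = "\<lambda>i. q_falling CARD('a) i :: int poly"
  have "?A \<subseteq> Pow ?V" by (auto simp: q_graphical_arrangement_def)
  then have finA: "finite ?A" using finite_coord_space finite_subset by blast
  have finX: "finite ?X" using finite_coord_space[of l, where 'a = 'a] by simp
  have "fun_vs.char_poly ?V ?A = (\<Sum>W\<in>?X. ?f (fun_vs.dim W))"
    using fin_vs.char_poly_q_falling_expansion[OF subspace_coord_space finite_coord_space finA arrangement_hyperplanes]
    by simp
  also have "\<dots> = (\<Sum>i\<le>l. \<Sum>W | W \<in> ?X \<and> fun_vs.dim W = i. ?f (fun_vs.dim W))"
    using finX dim_le_of_subset_coord_space by (intro sum.group[symmetric]) auto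
  also have "\<dots> = (\<Sum>i\<le>l. \<Sum>W \<in> (avoiding_subspaces l E i :: (nat \<Rightarrow> 'a) set set). ?f i)"
  proof (rule sum.cong)
    fix i
    have "{W. W \<in> ?X \<and> fun_vs.dim W = i} = avoiding_subspaces l E i"
      unfolding avoiding_subspaces_def by blast
    moreover have "(\<Sum>W | W \<in> ?X \<and> fun_vs.dim W = i. ?f (fun_vs.dim W))
        = (\<Sum>W | W \<in> ?X \<and> fun_vs.dim W = i. ?f i)"
      by (rule sum.cong) auto
    ultimately show "(\<Sum>W | W \<in> ?X \<and> fun_vs.dim W = i. ?f (fun_vs.dim W))
        = (\<Sum>W \<in> (avoiding_subspaces l E i :: (nat \<Rightarrow> 'a) set set). ?f i)" by simp
  qed simp
  also have "\<dots> = (\<Sum>i\<le>l. smult (int (card (avoiding_subspaces l E i :: (nat \<Rightarrow> 'a) set set))) (?f i))"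
    by (simp add: of_nat_poly)
  finally show ?thesis .
qed

theorem theorem2p9:
  fixes l q :: nat and E :: "nat set set"
    and A :: "(nat \<Rightarrow> 'a::{field,finite}) set set"
  defines "A \<equiv> q_graphical_arrangement l E"
  defines "expansion \<equiv> \<lambda>c :: nat \<Rightarrow> rat.
             map_poly of_int (fun_vs.char_poly (coord_space l) A) =
             (\<Sum>i\<le>l. smult (c i) (q_falling q i))"
  assumes "simple_graph {1..l} E"
    and "CARD('a) = q"
  shows "(\<exists>c. expansion c) \<and>
         (\<forall>c. expansion c \<longrightarrow>
           (\<forall>i\<le>l. \<exists>m::nat.
              c i / (of_nat q - 1) ^ (l - i) = of_nat m \<and>
              [m = card {P. stable_partition {1..l} E P \<and> card P = i}] (mod (q - 1))))"
proof -
  define N where "N i = card (avoiding_subspaces l E i :: (nat \<Rightarrow> 'a) set set)" for i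
  have "map_poly of_int (smult (int n) p) = smult (of_nat n) (map_poly of_int p :: rat poly)" for n p
    by (intro poly_eqI) (simp add: coeff_map_poly)
  then have expand: "map_poly of_int (fun_vs.char_poly (coord_space l) A)
      = (\<Sum>i\<le>l. smult (of_nat (N i) :: rat) (q_falling q i))"
    unfolding A_def char_poly_arrangement map_poly_of_int_sum
    by (simp add: map_poly_of_int_q_falling N_def assms(4))
  have q: "2 \<le> q" using field_card_ge_2[where 'a = 'a] assms(4) by simp
  have "\<exists>m::nat. c i / (of_nat q - 1) ^ (l - i) = of_nat m \<and>
          [m = card {P. stable_partition {1..l} E P \<and> card P = i}] (mod (q - 1))"
    if c: "expansion c" and i: "i \<le> l" for c i
  proof -
    let ?s = "card {P. stable_partition {1..l} E P \<and> card P = i}"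
    obtain z where z: "N i = (q - 1) ^ (l - i) * (?s + (q - 1) * z)"
      using card_avoiding_subspaces[OF assms(3), of i, where 'a = 'a] unfolding N_def assms(4) by blast
    have "c i = of_nat (N i)"
      using c expand i unfolding expansion_def by (intro q_falling_expansion_unique[where q = q]) auto
    also have "\<dots> = (of_nat q - 1) ^ (l - i) * of_nat (?s + (q - 1) * z)"
      using q by (simp only: z of_nat_mult of_nat_power) (simp add: of_nat_diff)
    finally have "c i / (of_nat q - 1) ^ (l - i) = of_nat (?s + (q - 1) * z)"
      using q by simp
    moreover have "[?s + (q - 1) * z = ?s] (mod (q - 1))" by (simp add: cong_def)
    ultimately show ?thesis by blast
  qed
  moreover have "expansion (\<lambda>i. of_nat (N i))" unfolding expansion_def by (rule expand)
  ultimately show ?thesis by blast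
qed

end
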